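(* Assume that the noise terms $\xi_i$ are subgaussian with parameter $\sigma>0$, i.e. $\mathbb E[e^{u\xi_i}]\le e^{u^2\sigma^2/2}$ for all $u\in\mathbb R$. Let $R_n=\left\lfloor \left(\frac{n}{\ln n} \right)^{\frac{d-1}{d+1}}\right\rfloor$ and, for all integers $r\ge d+1$ and for $r=\infty$, let $$\phi_{n,r}=\min\left(\frac{r\ln n}{n},\left(\frac{\ln n}{n}\right)^{\frac{2}{d+1}}\right).$$ There exists a positive constant $C_5$ that depends on $d$ and $\sigma$ only, such that the adaptive estimator $\hat P_n^{adapt}$ satisfies $$\sup_{d+1\leq r\leq \infty}\ \sup_{P\in\mathcal P_r} \mathbb E_P\left[\phi_{n,r}^{-1}\,|\hat P_n^{adapt}\triangle P|\right] \leq C_5$$ for all integers $n\ge 2$ such that $R_n\ge d+1$, where $\mathcal P_\infty=\mathcal C_d$.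
   Context: Let $d\ge 2$ be an integer. One observes $n$ i.i.d. pairs $(X_i,Y_i)$, $i=1,\dots,n$, with $X_i$ uniformly distributed on $[0,1]^d$ and $Y_i=I(X_i\in G)+\xi_i$, where $G\subseteq[0,1]^d$ is unknown, $I(\cdot\in G)$ is the indicator function of $G$, and the errors $\xi_1,\dots,\xi_n$ are i.i.d. real random variables independent of $(X_1,\dots,X_n)$. $\mathbb P_G$, $\mathbb E_G$ denote probability and expectation with respect to the distribution of the $n$ pairs. $|\cdot|$ is Lebesgue measure on $\mathbb R^d$, $\triangle$ is symmetric difference, and $\lfloor x\rfloor$ is the greatest integer less than or equal to $x$. All convex sets (in particular polytopes) considered are compact with nonempty interior. $\mathcal C_d$ is the class of all (compact) convex sets included in $[0,1]^d$. For finite $r\ge d+1$, $\mathcal P_r$ is the class of all convex polytopes contained in $[0,1]^d$ with at most $r$ vertices, and $\mathcal P_r^{(n)}$ is the (finite) class of all convex polytopes in $[0,1]^d$ with at most $r$ vertices whose vertices have coordinates that are integer multiples of $1/n$. Put $\mathcal A(P)=\sum_{i=1}^n(1-2Y_i)I(X_i\in P)$. The estimator $\hat P_n^{(r)}$ is any (measurable) choice of an element of $\operatorname{argmin}_{P\in\mathcal P_r^{(n)}}\mathcal A(P)$. $C_1,C_2>0$ denote fixed constants, depending on $d$ and $\sigma$ only, for which the deviation inequality $$\sup_{P\in\mathcal P_r}\mathbb P_{P}\Big[n\Big(|\hat P_n^{(r)}\triangle P|-\frac{2dr\ln n}{C_2n}\Big)\geq x\Big] \leq C_1e^{-C_2x},\quad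 \forall x>0,$$ holds for all $n\ge1$ and $r\ge d+1$ (such constants exist under the subgaussian assumption). Define $$\hat r=\min\left\{ r\in\{d+1,\ldots,R_n\} : |\hat P_n^{(r)}\triangle\hat P_n^{(r')}|\leq \frac{6dr'\ln n}{C_2n},\ \forall r'=r,\ldots,R_n\right\}$$ (the set is nonempty since it contains $R_n$), and $\hat P_n^{adapt}=\hat P_n^{(\hat r)}$. *)

theory Defs
  imports "HOL-Probability.Probability"
begin

type_synonym 'd sample = "nat \<Rightarrow> (real ^ 'd) \<times> real"

definition unit_cube :: "(real ^ 'd) set" where
  "unit_cube = {x. \<forall>i. 0 \<le> x $ i \<and> x $ i \<le> 1}"

definition subgaussian_law :: "real \<Rightarrow> real measure \<Rightarrow> bool" where
  "subgaussian_law \<sigma> \<nu> \<longleftrightarrow>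
     prob_space \<nu> \<and> sets \<nu> = sets borel \<and>
     (\<forall>u. integrable \<nu> (\<lambda>x. exp (u * x)) \<and>
          (\<integral>x. exp (u * x) \<partial>\<nu>) \<le> exp (u\<^sup>2 * \<sigma>\<^sup>2 / 2))"

(* The law of one pair (X, I(X \<in> G) + \<xi>), where \<xi> has law \<nu> and is independent of X. *)
definition obs_law :: "real measure \<Rightarrow> (real ^ 'd) set \<Rightarrow> ((real ^ 'd) \<times> real) measure" where
  "obs_law \<nu> G =
     distr (uniform_measure lborel unit_cube \<Otimes>\<^sub>M \<nu>) (borel \<Otimes>\<^sub>M borel)
       (\<lambda>(x, e). (x, indicator G x + e))"

(* The sample is indexed by {..<n} rather than {1..n}. *)
definition sample_law :: "nat \<Rightarrow> real measure \<Rightarrow> (real ^ 'd) set \<Rightarrow> 'd sample measure" where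
  "sample_law n \<nu> G = PiM {..<n} (\<lambda>_. obs_law \<nu> G)"

definition convex_class :: "(real ^ 'd) set set" where
  "convex_class = {G. convex G \<and> compact G \<and> interior G \<noteq> {} \<and> G \<subseteq> unit_cube}"

definition polytope_class :: "nat \<Rightarrow> (real ^ 'd) set set" where
  "polytope_class r =
     {P. polytope P \<and> interior P \<noteq> {} \<and> P \<subseteq> unit_cube \<and> card {v. v extreme_point_of P} \<le> r}"

definition grid_polytope_class :: "nat \<Rightarrow> nat \<Rightarrow> (real ^ 'd) set set" where
  "grid_polytope_class n r =
     {P \<in> polytope_class r. \<forall>v. v extreme_point_of P \<longrightarrow> (\<forall>i. \<exists>k::int. v $ i = of_int k / real n)}"

definition shape_class :: "enat \<Rightarrow> (real ^ 'd) set set" where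
  "shape_class r = (case r of enat k \<Rightarrow> polytope_class k | \<infinity> \<Rightarrow> convex_class)"

definition contrast :: "nat \<Rightarrow> 'd sample \<Rightarrow> (real ^ 'd) set \<Rightarrow> real" where
  "contrast n \<omega> P = (\<Sum>i<n. (1 - 2 * snd (\<omega> i)) * indicator P (fst (\<omega> i)))"

(* Measurability is with respect to the discrete sigma-algebra on the finite class. *)
definition is_estimator :: "nat \<Rightarrow> nat \<Rightarrow> ('d sample \<Rightarrow> (real ^ 'd) set) \<Rightarrow> bool" where
  "is_estimator n r T \<longleftrightarrow>
     T \<in> measurable (PiM {..<n} (\<lambda>_. borel \<Otimes>\<^sub>M borel)) (count_space (grid_polytope_class n r)) \<and>
     (\<forall>\<omega> \<in> space (PiM {..<n} (\<lambda>_. borel \<Otimes>\<^sub>M borel)).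
        is_arg_min (contrast n \<omega>) (\<lambda>P. P \<in> grid_polytope_class n r) (T \<omega>))"

definition sd_vol :: "(real ^ 'd) set \<Rightarrow> (real ^ 'd) set \<Rightarrow> real" where
  "sd_vol A B = measure lborel (sym_diff A B)"

definition R_max :: "nat \<Rightarrow> nat \<Rightarrow> nat" where
  "R_max d n = nat \<lfloor>(real n / ln (real n)) powr ((real d - 1) / (real d + 1))\<rfloor>"

definition rate :: "nat \<Rightarrow> nat \<Rightarrow> enat \<Rightarrow> real" where
  "rate d n r =
     (case r of
        enat k \<Rightarrow> min (real k * ln (real n) / real n) ((ln (real n) / real n) powr (2 / (real d + 1)))
      | \<infinity> \<Rightarrow> (ln (real n) / real n) powr (2 / (real d + 1)))"

(* In the next two definitions T r is the estimator over polytopes with at most r vertices. *)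
definition r_hat :: "real \<Rightarrow> nat \<Rightarrow> (nat \<Rightarrow> 'd sample \<Rightarrow> (real ^ 'd) set) \<Rightarrow> 'd sample \<Rightarrow> nat" where
  "r_hat C\<^sub>2 n T \<omega> =
     Min {r \<in> {CARD('d) + 1..R_max CARD('d) n}.
            \<forall>r' \<in> {r..R_max CARD('d) n}.
              sd_vol (T r \<omega>) (T r' \<omega>)
                \<le> 6 * real CARD('d) * real r' * ln (real n) / (C\<^sub>2 * real n)}"

definition adaptive ::
  "real \<Rightarrow> nat \<Rightarrow> (nat \<Rightarrow> 'd sample \<Rightarrow> (real ^ 'd) set) \<Rightarrow> 'd sample \<Rightarrow> (real ^ 'd) set" where
  "adaptive C\<^sub>2 n T \<omega> = T (r_hat C\<^sub>2 n T \<omega>) \<omega>"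

end

(* The selection rule gives |P_adapt - P_r'| <= 6 d r' ln n / (C2 n) for every r' >= r_hat.

   If r <= R_n, then on the event that all estimators of index r' >= r, and the estimator of index r
   itself, deviate from P by less than 3 d r' ln n / (C2 n), the rule stops at some r_hat <= r, and the
   triangle inequality gives a loss of order r ln n / n; the complementary event has probability
   O(R_n / n^2) by the deviation inequality.

   If r > R_n, the deviation inequality is useless because the truth G need not be a polytope with
   few vertices. Taking r' = R_n in the selection rule reduces the claim to the risk of the estimator
   of index R_n at an arbitrary convex G. A Chernoff bound for A(P) - A(Q) and a union over the at
   most (n+1)^(d r) grid polytopes bound this risk by |Q - G| + R_n ln n / n up to constants, for any
   grid polytope Q. A good Q is the convex hull of the projections to G of a grid of mesh 3/m on the
   boundary of [-1,2]^d, rounded to multiples of 1/n: its Hausdorff distance to G is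
   O(1/m^2 + 1/n), with O(m^(d-1)) vertices. *)
theory Submission
  imports Defs
begin

text \<open>The exponents meet at x = (n / ln n)^(1/(d+1)): R_n is the integer part of x^(d-1), and
  the rate for r = infinity is x^(-2). A net with mesh of order 1/x on a hypersurface has order
  x^(d-1) points, and the hull built from it misses the body by only the square of the mesh, so R_n
  vertices buy exactly the required error. The square needs no smoothness: nearest-point projection
  turns a displacement e of the outer point into a loss of at most |e|^2 in the support function.
  Passing from distance to volume must cost a constant uniform over all convex bodies in the cube,
  since C_5 may depend on d and sigma only. The factor 6 in the selection rule is 3 + 3, for two
  estimators each close to P, and 3 is 2 + 1: the 2 is the centering of the deviation inequality,
  and the 1 leaves a probability of order n^(-d r') <= n^(-2). With at most 2 R_n <= 4 n failure
  events the total is still of order 1/n. The loss of Q then enters with a factor larger than 1,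
  which is harmless for rates.\<close>

section \<open>Volume of neighborhoods of convex bodies\<close>

(* Along the direction v, E - K sits directly above K, so its translates by multiples of v are
   stacked without overlap; this replaces a surface area argument. *)
lemma extrusion_translates_disjoint:
  fixes K :: "'a::real_vector set"
  assumes K: "convex K" and E: "E = {x + t *\<^sub>R v |x t. x \<in> K \<and> t \<in> {0..1}}"
    and jk: "j < (k::nat)"
  shows "(+) (real j *\<^sub>R v) ` (E - K) \<inter> (+) (real k *\<^sub>R v) ` (E - K) = {}"
proof (rule ccontr)
  assume "\<not> ?thesis"
  then obtain x y where x: "x \<in> E" "x \<notin> K" and y: "y \<in> E" "y \<notin> K"
    and xy: "real j *\<^sub>R v + x = real k *\<^sub>R v + y" by auto
  obtain p s where p: "x = p + s *\<^sub>R v" "p \<in> K" "0 \<le> s" "s \<le> 1"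
    using x(1) E by auto
  obtain q t where q: "y = q + t *\<^sub>R v" "q \<in> K" "0 \<le> t" "t \<le> 1"
    using y(1) E by auto
  define D where "D = real k - real j"
  have D: "D \<ge> 1" using jk unfolding D_def by linarith
  have "x = y + D *\<^sub>R v"
    using xy unfolding D_def by (simp add: algebra_simps)
  then have pq: "p = q + (D + t - s) *\<^sub>R v"
    using p(1) q(1) by (simp add: algebra_simps)
  show False
  proof (cases "D + t - s = 0")
    case True
    \<comment> \<open>\<open>D \<ge> 1\<close>, \<open>s \<le> 1\<close> and
      \<open>t \<ge> 0\<close> leave only D = s = 1 and t = 0, so y is the base point q
      itself.\<close>
    then have "t = 0" using D p q by linarith
    then show False using q y by simp
  next
    case False
    then have pos: "D + t - s > 0" using D p q by linarith
    \<comment> \<open>On the line through q in direction v, the point y sits between q and p, at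
      fraction \<open>w\<close> of the way.\<close>
    define w where "w = t / (D + t - s)"
    have w: "0 \<le> w" "w \<le> 1" using pos q D p unfolding w_def by (auto simp: field_simps)
    have "w * (D + t - s) = t" using pos unfolding w_def by simp
    then have "y = q + (w * (D + t - s)) *\<^sub>R v"
      using q(1) by simp
    then have "y = (1 - w) *\<^sub>R q + w *\<^sub>R p"
      unfolding pq by (simp add: algebra_simps)
    then have "y \<in> K" using K w p(2) q(2) convexD_alt by metis
    then show False using y by simp
  qed
qed

lemma compact_extrusion:
  fixes K :: "'a::real_normed_vector set"
  assumes "compact K"
  shows "compact {x + t *\<^sub>R v |x t. x \<in> K \<and> t \<in> {0..1::real}}"
proof -
  have "compact ((\<lambda>(x, t). x + t *\<^sub>R v) ` (K \<times> {0..1}))"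
    using assms
    by (intro compact_continuous_image compact_Times) (auto simp: case_prod_unfold intro!: continuous_intros)
  moreover have "(\<lambda>(x, t). x + t *\<^sub>R v) ` (K \<times> {0..1}) = {x + t *\<^sub>R v |x t. x \<in> K \<and> t \<in> {0..1}}"
    by force
  ultimately show ?thesis by simp
qed

text \<open>Packing argument: the M translates of \<open>E - K\<close> are disjoint, have equal
  measure and all fit into B.\<close>

lemma measure_extrusion:
  fixes K :: "'a::euclidean_space set"
  assumes K: "convex K" "compact K" and E: "E = {x + t *\<^sub>R v |x t. x \<in> K \<and> t \<in> {0..1}}"
    and B: "B \<in> lmeasurable"
    and sub: "\<And>j x. j < M \<Longrightarrow> x \<in> E \<Longrightarrow> real j *\<^sub>R v + x \<in> B"
  shows "real M * measure lebesgue (E - K) \<le> measure lebesgue B"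
proof -
  have "compact E" unfolding E by (rule compact_extrusion[OF K(2)])
  then have E_K: "E - K \<in> lmeasurable"
    using K(2) by (intro fmeasurable.Diff lmeasurable_compact)
  have "real M * measure lebesgue (E - K)
      = (\<Sum>j<M. measure lebesgue ((+) (real j *\<^sub>R v) ` (E - K)))"
    by (simp add: measure_translation)
  also have "\<dots> = measure lebesgue (\<Union>j<M. (+) (real j *\<^sub>R v) ` (E - K))"
  proof (rule measure_UNION'[symmetric])
    show "pairwise (\<lambda>i j. disjnt ((+) (real i *\<^sub>R v) ` (E - K)) ((+) (real j *\<^sub>R v) ` (E - K))) {..<M}"
      unfolding pairwise_def disjnt_def
      using extrusion_translates_disjoint[OF K(1) E] by (metis inf_commute nat_neq_iff)
  qed (use E_K measurable_translation in auto)
  also have "\<dots> \<le> measure lebesgue B"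
  proof (rule measure_mono_fmeasurable[OF _ _ B])
    show "(\<Union>j<M. (+) (real j *\<^sub>R v) ` (E - K)) \<subseteq> B" using sub by auto
    show "(\<Union>j<M. (+) (real j *\<^sub>R v) ` (E - K)) \<in> sets lebesgue"
      using E_K measurable_translation by (intro sets.finite_UN) (auto intro: fmeasurableD)
  qed
  finally show ?thesis .
qed

text \<open>About 1/eta translates fit into a fixed box. The shifts
  \<open>real j *\<^sub>R v\<close> and the extrusion each move a point by at most 1, so [-1,2]^d
  grows to [-3,4]^d, whose volume is 7^d. The box [-1,2]^d leaves room for a subset of the unit cube
  that has already been thickened by up to 1.\<close>

lemma measure_extrusion_le:
  fixes K :: "'a::euclidean_space set"
  assumes K: "convex K" "compact K" "K \<subseteq> cbox (- One) (2 *\<^sub>R One)"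
    and E: "E = {x + t *\<^sub>R v |x t. x \<in> K \<and> t \<in> {0..1}}"
    and v: "norm v \<le> \<eta>" "0 < \<eta>" "\<eta> \<le> 1"
  shows "measure lebesgue (E - K) \<le> 7 ^ DIM('a) * \<eta>"
proof -
  define M where "M = nat \<lceil>1 / \<eta>\<rceil>"
  have M: "1 / \<eta> \<le> real M" using v unfolding M_def by linarith
  have sub: "real j *\<^sub>R v + x \<in> cbox (- 3 *\<^sub>R One) (4 *\<^sub>R One)" if j: "j < M" and x: "x \<in> E" for j x
  proof -
    have "real j \<le> 1 / \<eta>" using j unfolding M_def by linarith
    then have "real j * norm v \<le> 1 / \<eta> * \<eta>" using v by (intro mult_mono) auto
    then have nj: "norm (real j *\<^sub>R v) \<le> 1" using v by simp
    obtain y t where y: "x = y + t *\<^sub>R v" "y \<in> K" "0 \<le> t" "t \<le> 1" using x E by auto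
    have nt: "norm (t *\<^sub>R v) \<le> 1" using y v mult_mono[of t 1 "norm v" 1] by simp
    have "- 3 \<le> (real j *\<^sub>R v + x) \<bullet> b \<and> (real j *\<^sub>R v + x) \<bullet> b \<le> 4" if b: "b \<in> Basis" for b
    proof -
      have "- 1 \<le> y \<bullet> b" "y \<bullet> b \<le> 2" using K(3) y(2) b by (force simp: mem_box)+
      moreover have "\<bar>(real j *\<^sub>R v) \<bullet> b\<bar> \<le> 1" "\<bar>(t *\<^sub>R v) \<bullet> b\<bar> \<le> 1"
        using Basis_le_norm[OF b] nj nt order_trans by blast+
      ultimately show ?thesis unfolding y(1) inner_add_left by linarith
    qed
    then show ?thesis by (simp add: mem_box)
  qed
  have "measure lebesgue (cbox (- 3 *\<^sub>R One) (4 *\<^sub>R One) :: 'a set) = 7 ^ DIM('a)"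
    by (simp add: content_cbox scaleR_add_left[symmetric] prod.cong[of Basis Basis _ "\<lambda>_. 7"])
  with measure_extrusion[OF K(1,2) E _ sub, of M]
  have "real M * measure lebesgue (E - K) \<le> 7 ^ DIM('a)" by simp
  moreover have "1 / \<eta> * measure lebesgue (E - K) \<le> real M * measure lebesgue (E - K)"
    using M by (rule mult_right_mono) simp
  ultimately have "1 / \<eta> * measure lebesgue (E - K) \<le> 7 ^ DIM('a)" by linarith
  then show ?thesis using v by (simp add: field_simps)
qed

text \<open>The box is flat outside the directions in T, which allows thickening one direction at a
  time.\<close>

lemma mem_cbox_Basis_subset:
  fixes w :: "'a::euclidean_space"
  assumes T: "T \<subseteq> Basis"
  shows "w \<in> cbox (- (\<Sum>i\<in>T. \<eta> *\<^sub>R i)) (\<Sum>i\<in>T. \<eta> *\<^sub>R i)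
    \<longleftrightarrow> (\<forall>j\<in>Basis. \<bar>w \<bullet> j\<bar> \<le> (if j \<in> T then \<eta> else 0))"
proof -
  have "finite T" using T by (rule finite_subset) simp
  have "(\<Sum>i\<in>T. \<eta> *\<^sub>R i) \<bullet> j = (if j \<in> T then \<eta> else 0)" if "j \<in> Basis" for j
  proof -
    have "(\<Sum>i\<in>T. \<eta> *\<^sub>R i) \<bullet> j = (\<Sum>i\<in>T. if i = j then \<eta> else 0)"
      unfolding inner_sum_left using T that by (intro sum.cong) (auto simp: inner_Basis)
    then show ?thesis using \<open>finite T\<close> by simp
  qed
  then show ?thesis unfolding mem_box inner_minus_left
    by (intro ball_cong refl) (simp only: abs_le_iff, linarith)
qed

text \<open>Induction over the directions in S. Thickening \<open>N S\<close> in one more direction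
  b is covered by its two extrusions along eta b and -eta b, and each of them adds at most 7^d eta.
  The sets \<open>N S\<close> stay convex and compact, so the extrusion bound applies at each
  stage.\<close>

lemma measure_box_thickening:
  fixes K :: "'a::euclidean_space set"
  assumes K: "convex K" "compact K" "K \<subseteq> cbox 0 One" and \<eta>: "0 < \<eta>" "\<eta> \<le> 1"
    and S: "finite S" "S \<subseteq> Basis"
  defines "N \<equiv> \<lambda>S. (\<Union>x\<in>K. \<Union>w\<in>cbox (- (\<Sum>i\<in>S. \<eta> *\<^sub>R i)) (\<Sum>i\<in>S. \<eta> *\<^sub>R i). {x + w})"
  shows "measure lebesgue (N S - K) \<le> 2 * real (card S) * 7 ^ DIM('a) * \<eta>"
  using S
proof (induction S rule: finite_induct)
  case empty
  have "N {} = K" unfolding N_def by auto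
  then show ?case by simp
next
  case (insert b S)
  have bas: "b \<in> Basis" "S \<subseteq> Basis" using insert by auto
  have cN: "convex (N S)" "compact (N S)"
    unfolding N_def by (intro convex_sums compact_sums' convex_box compact_cbox K)+
  have boxN: "N S \<subseteq> cbox (- One) (2 *\<^sub>R One)"
  proof
    fix z assume "z \<in> N S"
    then obtain x w where z: "z = x + w" "x \<in> K" "w \<in> cbox (- (\<Sum>i\<in>S. \<eta> *\<^sub>R i)) (\<Sum>i\<in>S. \<eta> *\<^sub>R i)"
      unfolding N_def by auto
    have "- 1 \<le> z \<bullet> j \<and> z \<bullet> j \<le> 2" if j: "j \<in> Basis" for j
    proof -
      have "0 \<le> x \<bullet> j" "x \<bullet> j \<le> 1" using K(3) z(2) j by (force simp: mem_box)+
      moreover have "\<bar>w \<bullet> j\<bar> \<le> 1" using z(3) j \<eta> unfolding mem_cbox_Basis_subset[OF bas(2)] by (auto split: if_splits)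
      ultimately show ?thesis unfolding z(1) inner_add_left by linarith
    qed
    then show "z \<in> cbox (- One) (2 *\<^sub>R One)" by (simp add: mem_box)
  qed
  define E where "E = (\<lambda>v. {x + t *\<^sub>R v |x t. x \<in> N S \<and> t \<in> {0..1::real}})"
  have meas: "E v - N S \<in> lmeasurable" for v
    unfolding E_def by (intro fmeasurable.Diff lmeasurable_compact compact_extrusion cN)
  have le: "measure lebesgue (E v - N S) \<le> 7 ^ DIM('a) * \<eta>" if "norm v \<le> \<eta>" for v
    using measure_extrusion_le[OF cN boxN _ that \<eta>] E_def by blast
  have cover: "N (insert b S) \<subseteq> E (\<eta> *\<^sub>R b) \<union> E (- \<eta> *\<^sub>R b)"
  proof
    fix z assume "z \<in> N (insert b S)"
    then obtain x w where z: "z = x + w" "x \<in> K"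
      "w \<in> cbox (- (\<Sum>i\<in>insert b S. \<eta> *\<^sub>R i)) (\<Sum>i\<in>insert b S. \<eta> *\<^sub>R i)"
      unfolding N_def by auto
    have wj: "\<bar>w \<bullet> j\<bar> \<le> (if j \<in> insert b S then \<eta> else 0)" if "j \<in> Basis" for j
      using z(3) that unfolding mem_cbox_Basis_subset[OF insert.prems] by blast
    define w' where "w' = w - (w \<bullet> b) *\<^sub>R b"
    have "\<bar>w' \<bullet> j\<bar> \<le> (if j \<in> S then \<eta> else 0)" if "j \<in> Basis" for j
      using wj[OF that] bas that insert.hyps unfolding w'_def
      by (cases "j = b") (auto simp: inner_diff_left inner_Basis)
    then have "w' \<in> cbox (- (\<Sum>i\<in>S. \<eta> *\<^sub>R i)) (\<Sum>i\<in>S. \<eta> *\<^sub>R i)"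
      using mem_cbox_Basis_subset[OF bas(2)] by blast
    then have "x + w' \<in> N S" unfolding N_def using z(2) by blast
    \<comment> \<open>The component along b is split off and written as a fraction in [0,1] of eta b
      or of -eta b, according to its sign.\<close>
    moreover have "z = (x + w') + (\<bar>w \<bullet> b\<bar> / \<eta>) *\<^sub>R ((if w \<bullet> b \<ge> 0 then \<eta> else - \<eta>) *\<^sub>R b)"
      unfolding z(1) w'_def using \<eta> by (auto simp: abs_if)
    moreover have "\<bar>w \<bullet> b\<bar> / \<eta> \<in> {0..1}" using wj[OF bas(1)] \<eta> by (auto simp: divide_simps)
    ultimately have "z \<in> E ((if w \<bullet> b \<ge> 0 then \<eta> else - \<eta>) *\<^sub>R b)"
      unfolding E_def by blast
    then show "z \<in> E (\<eta> *\<^sub>R b) \<union> E (- \<eta> *\<^sub>R b)" by (auto split: if_splits)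
  qed
  have mN: "N T - K \<in> lmeasurable" for T
    unfolding N_def by (intro fmeasurable.Diff lmeasurable_compact compact_sums' compact_cbox K)
  have "measure lebesgue (N (insert b S) - K)
      \<le> measure lebesgue ((N S - K) \<union> ((E (\<eta> *\<^sub>R b) - N S) \<union> (E (- \<eta> *\<^sub>R b) - N S)))"
    using cover by (intro measure_mono_fmeasurable fmeasurable.Un fmeasurableD mN meas) auto
  also have "\<dots> \<le> measure lebesgue (N S - K)
      + (measure lebesgue (E (\<eta> *\<^sub>R b) - N S) + measure lebesgue (E (- \<eta> *\<^sub>R b) - N S))"
    by (intro order_trans[OF measure_Un_le] add_mono order_refl measure_Un_le fmeasurableD mN meas
        fmeasurable.Un)
  also have "\<dots> \<le> 2 * real (card S) * 7 ^ DIM('a) * \<eta> + (7 ^ DIM('a) * \<eta> + 7 ^ DIM('a) * \<eta>)"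
    using insert.IH[OF bas(2)] le \<eta> bas by (intro add_mono) auto
  also have "\<dots> = 2 * real (card (insert b S)) * 7 ^ DIM('a) * \<eta>"
    using insert.hyps by (simp add: algebra_simps)
  finally show ?case .
qed

text \<open>A Euclidean ball of radius eta lies in the cube of half-width eta, so thickening in all
  basis directions covers A.\<close>

lemma measure_neighborhood_diff:
  fixes K :: "'a::euclidean_space set"
  assumes K: "convex K" "compact K" "K \<subseteq> cbox 0 One" and \<eta>: "0 < \<eta>" "\<eta> \<le> 1"
    and A: "A \<in> sets lebesgue" "\<And>a. a \<in> A \<Longrightarrow> \<exists>x\<in>K. dist a x \<le> \<eta>"
  shows "measure lebesgue (A - K) \<le> 2 * real DIM('a) * 7 ^ DIM('a) * \<eta>"
proof -
  let ?N = "(\<Union>x\<in>K. \<Union>w\<in>cbox (- (\<Sum>i\<in>Basis. \<eta> *\<^sub>R i)) (\<Sum>i\<in>Basis. \<eta> *\<^sub>R i). {x + w})"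
  have "A \<subseteq> ?N"
  proof
    fix a assume "a \<in> A"
    then obtain x where x: "x \<in> K" "dist a x \<le> \<eta>" using A by blast
    have "\<bar>(a - x) \<bullet> j\<bar> \<le> \<eta>" if "j \<in> Basis" for j
      using Basis_le_norm[OF that, of "a - x"] x(2) by (simp add: dist_norm)
    then have "a - x \<in> cbox (- (\<Sum>i\<in>Basis. \<eta> *\<^sub>R i)) (\<Sum>i\<in>Basis. \<eta> *\<^sub>R i)"
      by (simp add: mem_cbox_Basis_subset)
    then show "a \<in> ?N" using x(1) by (intro UN_I[of x] UN_I[of "a - x"]) auto
  qed
  moreover have "?N - K \<in> lmeasurable"
    by (intro fmeasurable.Diff lmeasurable_compact compact_sums' compact_cbox K)
  moreover have "A - K \<in> sets lebesgue" using A(1) K(2) by (simp add: lmeasurable_compact fmeasurableD sets.Diff)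
  ultimately have "measure lebesgue (A - K) \<le> measure lebesgue (?N - K)"
    by (intro measure_mono_fmeasurable) auto
  also have "\<dots> \<le> 2 * real DIM('a) * 7 ^ DIM('a) * \<eta>"
    by (rule measure_box_thickening[OF K \<eta> finite_Basis order_refl])
  finally show ?thesis .
qed

section \<open>Approximation of convex bodies by grid polytopes\<close>

lemma unit_cube_cbox: "unit_cube = cbox 0 (1 :: real ^ 'd)"
  by (auto simp: unit_cube_def mem_box_cart)

lemma convex_unit_cube: "convex (unit_cube :: (real ^ 'd) set)"
  unfolding unit_cube_cbox by (rule convex_box)

text \<open>The bound \<open>k \<le> n\<close> builds the constraint to the unit cube into the grid.
  For n = 0 division by zero leaves only the origin.\<close>

definition grid :: "nat \<Rightarrow> (real ^ 'd) set" where
  "grid n = {v. \<forall>i. \<exists>k\<le>n. v $ i = real k / real n}"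

definition grid_floor :: "nat \<Rightarrow> real ^ 'd \<Rightarrow> real ^ 'd" where
  "grid_floor n x = (\<chi> i. of_int \<lfloor>real n * x $ i\<rfloor> / real n)"

lemma grid_floor_le:
  assumes "n > 0"
  shows "\<bar>grid_floor n x $ i - x $ i\<bar> \<le> 1 / real n"
proof -
  have "\<bar>of_int \<lfloor>real n * x $ i\<rfloor> - real n * x $ i\<bar> \<le> 1" by linarith
  moreover have "grid_floor n x $ i - x $ i = (of_int \<lfloor>real n * x $ i\<rfloor> - real n * x $ i) / real n"
    using assms by (simp add: grid_floor_def diff_divide_distrib)
  ultimately show ?thesis using assms by (simp add: divide_right_mono)
qed

lemma grid_floor_in_grid:
  assumes "n > 0" "x \<in> unit_cube"
  shows "grid_floor n x \<in> grid n"
  unfolding grid_def mem_Collect_eq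
proof
  fix i
  have x: "0 \<le> x $ i" "x $ i \<le> 1" using assms by (auto simp: unit_cube_def)
  have "0 \<le> real n * x $ i" "real n * x $ i \<le> real n"
    using x mult_left_mono[of "x $ i" 1 "real n"] by auto
  then show "\<exists>k\<le>n. grid_floor n x $ i = real k / real n"
    unfolding grid_floor_def by (intro exI[of _ "nat \<lfloor>real n * x $ i\<rfloor>"]) (auto simp: floor_le_iff, linarith)
qed

lemma grid_floor_fixes_01: "n > 0 \<Longrightarrow> x $ i \<in> {0, 1} \<Longrightarrow> grid_floor n x $ i = x $ i"
  by (elim insertE) (simp_all add: grid_floor_def)

section \<open>Counting grid points\<close>

lemma vec_set_eq_image_PiE:
  "{v :: 'a ^ 'd. \<forall>i. v $ i \<in> A i} = vec_lambda ` PiE UNIV A"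
proof
  show "{v :: 'a ^ 'd. \<forall>i. v $ i \<in> A i} \<subseteq> vec_lambda ` PiE UNIV A"
  proof
    fix v :: "'a ^ 'd" assume "v \<in> {v. \<forall>i. v $ i \<in> A i}"
    then have "vec_nth v \<in> PiE UNIV A" by auto
    then show "v \<in> vec_lambda ` PiE UNIV A" by (metis imageI vec_nth_inverse)
  qed
qed auto

lemma finite_vec_set:
  assumes "\<And>i. finite (A i)"
  shows "finite {v :: 'a ^ 'd. \<forall>i. v $ i \<in> A i}"
  unfolding vec_set_eq_image_PiE using assms by (intro finite_imageI finite_PiE) auto

lemma card_vec_set:
  assumes "\<And>i. finite (A i)"
  shows "card {v :: 'a ^ 'd. \<forall>i. v $ i \<in> A i} = (\<Prod>i\<in>UNIV. card (A i))"
proof -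
  have "inj_on (vec_lambda :: _ \<Rightarrow> 'a ^ 'd) (PiE UNIV A)"
    by (rule inj_onI) (simp add: vec_lambda_inject)
  then have "card (vec_lambda ` PiE UNIV A :: ('a ^ 'd) set) = card (PiE UNIV A)"
    by (rule card_image)
  then show ?thesis
    unfolding vec_set_eq_image_PiE by (simp add: card_PiE)
qed

lemma grid_eq: "grid n = {v. \<forall>i. v $ i \<in> (\<lambda>k. real k / real n) ` {..n}}"
  unfolding grid_def image_iff Bex_def atMost_iff by (rule refl)

lemma finite_grid: "finite (grid n)"
  unfolding grid_eq by (rule finite_vec_set) simp

lemma card_grid_le: "card (grid n :: (real ^ 'd) set) \<le> (n + 1) ^ CARD('d)"
proof -
  have "card (grid n :: (real ^ 'd) set) = card ((\<lambda>k. real k / real n) ` {..n}) ^ CARD('d)"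
    unfolding grid_eq by (subst card_vec_set) auto
  also have "\<dots> \<le> card {..n} ^ CARD('d)" by (intro power_mono card_image_le) auto
  finally show ?thesis by simp
qed

definition grid_boundary :: "nat \<Rightarrow> (real ^ 'd) set" where
  "grid_boundary m = {v \<in> grid m. \<exists>i. v $ i \<in> {0, 1}}"

lemma finite_grid_boundary: "finite (grid_boundary m)"
  unfolding grid_boundary_def by (rule finite_subset[OF _ finite_grid]) auto

text \<open>One coordinate is frozen to two values and d - 1 stay free. The exponent d - 1 is what
  makes the vertex count comparable with R_n.\<close>

lemma card_grid_boundary_le:
  "card (grid_boundary m :: (real ^ 'd) set) \<le> 2 * CARD('d) * (m + 1) ^ (CARD('d) - 1)"
proof -
  define A where "A = (\<lambda>i j :: 'd. if j = i then {0, 1 :: real} else (\<lambda>k. real k / real m) ` {..m})"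
  have fin: "finite (A i j)" for i j unfolding A_def by simp
  have "(grid_boundary m :: (real ^ 'd) set) \<subseteq> (\<Union>i. {v. \<forall>j. v $ j \<in> A i j})"
    unfolding grid_boundary_def grid_eq A_def by auto
  then have "card (grid_boundary m :: (real ^ 'd) set) \<le> card (\<Union>i. {v :: real ^ 'd. \<forall>j. v $ j \<in> A i j})"
    using finite_vec_set[of "A _"] fin by (intro card_mono) auto
  also have "\<dots> \<le> (\<Sum>i\<in>UNIV. card {v :: real ^ 'd. \<forall>j. v $ j \<in> A i j})"
    by (rule card_UN_le) simp
  also have "\<dots> \<le> (\<Sum>i\<in>(UNIV :: 'd set). 2 * (m + 1) ^ (CARD('d) - 1))"
  proof (rule sum_mono)
    fix i :: 'd
    have "card {v :: real ^ 'd. \<forall>j. v $ j \<in> A i j} = (\<Prod>j\<in>UNIV. card (A i j))"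
      by (rule card_vec_set[OF fin])
    also have "\<dots> = card (A i i) * (\<Prod>j\<in>UNIV - {i}. card (A i j))"
      by (subst prod.remove[of UNIV i]) auto
    also have "\<dots> \<le> 2 * (\<Prod>j\<in>UNIV - {i}. m + 1)"
    proof (intro mult_mono prod_mono)
      show "0 \<le> card (A i j) \<and> card (A i j) \<le> m + 1" if "j \<in> UNIV - {i}" for j
        using that card_image_le[of "{..m}" "\<lambda>k. real k / real m"] unfolding A_def by auto
    qed (auto simp: A_def card_insert_if)
    also have "\<dots> = 2 * (m + 1) ^ (CARD('d) - 1)" by (simp add: card_Diff_singleton)
    finally show "card {v :: real ^ 'd. \<forall>j. v $ j \<in> A i j} \<le> 2 * (m + 1) ^ (CARD('d) - 1)" .
  qed
  finally show ?thesis by simp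
qed

section \<open>Quadratic approximation of a convex body by nearest points\<close>

lemma norm_le_coords:
  fixes x :: "real ^ 'd"
  assumes "\<And>i. \<bar>x $ i\<bar> \<le> c"
  shows "(norm x)\<^sup>2 \<le> real CARD('d) * c\<^sup>2"
proof -
  have "(norm x)\<^sup>2 = (\<Sum>i\<in>UNIV. (x $ i)\<^sup>2)"
    unfolding power2_norm_eq_inner inner_vec_def by (simp add: power2_eq_square)
  also have "\<dots> \<le> (\<Sum>i\<in>(UNIV::'d set). c\<^sup>2)"
    using assms by (intro sum_mono) (metis abs_ge_zero power2_abs power_mono)
  finally show ?thesis by simp
qed

(* The ray leaves the cube [-1,2]^d at a parameter t \<ge> 1 since u is a unit vector. *)
lemma ray_hits_boundary:
  fixes u y :: "real ^ 'd"
  assumes u: "norm u = 1" and y: "y \<in> unit_cube"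
  obtains t i where "t \<ge> 1" "\<And>j. - 1 \<le> (y + t *\<^sub>R u) $ j" "\<And>j. (y + t *\<^sub>R u) $ j \<le> 2"
    "(y + t *\<^sub>R u) $ i \<in> {- 1, 2}"
proof -
  \<comment> \<open>\<open>f i\<close> is the parameter at which the ray crosses the face of
    [-1,2]^d that it approaches in coordinate i; the smallest one is the exit parameter.\<close>
  define f where "f = (\<lambda>i. if u $ i > 0 then (2 - y $ i) / u $ i else (- 1 - y $ i) / u $ i)"
  define J where "J = {i. u $ i \<noteq> 0}"
  have "J \<noteq> {}" using u unfolding J_def by (metis (mono_tags, lifting) Collect_empty_eq norm_zero vec_eq_iff zero_index zero_neq_one)
  define t where "t = Min (f ` J)"
  have yb: "0 \<le> y $ j" "y $ j \<le> 1" for j using y by (auto simp: unit_cube_def)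
  have ub: "\<bar>u $ j\<bar> \<le> 1" for j using component_le_norm_cart[of u j] u by simp
  have f1: "f j \<ge> 1" if "j \<in> J" for j
    using that yb[of j] ub[of j] unfolding f_def J_def by (auto simp: divide_simps)
  have "t \<in> f ` J" unfolding t_def using \<open>J \<noteq> {}\<close> by (intro Min_in) auto
  then obtain i where i: "i \<in> J" "t = f i" by auto
  have t1: "t \<ge> 1" using f1 i by simp
  have tj: "t \<le> f j" if "j \<in> J" for j unfolding t_def using that by (intro Min_le) auto
  have "- 1 \<le> y $ j + t * u $ j \<and> y $ j + t * u $ j \<le> 2" for j
  proof (cases "u $ j" "0 :: real" rule: linorder_cases)
    case equal
    then show ?thesis using yb[of j] by simp
  next
    case greater
    then have "t \<le> (2 - y $ j) / u $ j" using tj[of j] unfolding f_def J_def by simp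
    moreover have "0 \<le> t * u $ j" using greater t1 by simp
    ultimately show ?thesis using greater yb[of j] by (simp add: field_simps)
  next
    case less
    then have "t \<le> (- 1 - y $ j) / u $ j" using tj[of j] unfolding f_def J_def by simp
    moreover have "t * u $ j \<le> 0" using less t1 by (simp add: mult_nonneg_nonpos)
    ultimately show ?thesis using less yb[of j] by (simp add: field_simps)
  qed
  moreover have "y $ i + t * u $ i \<in> {- 1, 2}"
    using i unfolding f_def J_def by auto
  ultimately show ?thesis using that[OF t1, of i] by simp
qed

(* If z = y + t u has nearest point y in G, a point x near z has a nearest point q almost as
   extreme as y in direction u: the projection inequality <x - q, y - q> \<le> 0 reads
   |y - q|^2 + t <u, y - q> + <x - z, y - q> \<le> 0. *)
lemma closest_point_near_support:
  fixes G :: "'a::euclidean_space set"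
  assumes G: "convex G" "closed G" "y \<in> G" and t: "t \<ge> 1"
  shows "u \<bullet> (y - closest_point G x) \<le> (norm (x - (y + t *\<^sub>R u)))\<^sup>2"
proof -
  define q where "q = closest_point G x"
  define e where "e = x - (y + t *\<^sub>R u)"
  define w where "w = y - q"
  have "(x - q) \<bullet> w \<le> 0"
    using closest_point_dot[OF G] unfolding q_def w_def .
  moreover have "x - q = w + t *\<^sub>R u + e" unfolding e_def w_def by simp
  ultimately have "w \<bullet> w + t * (u \<bullet> w) + e \<bullet> w \<le> 0" by (simp add: inner_add_left)
  \<comment> \<open>Nonnegativity of |e + w|^2 bounds the cross term: - 2 <e, w> <= |e|^2 + |w|^2.
    The |w|^2 is absorbed by the one in the projection inequality, which leaves an error quadratic
    in e.\<close>
  moreover have "0 \<le> (e + w) \<bullet> (e + w)" by simp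
  then have "0 \<le> e \<bullet> e + 2 * (e \<bullet> w) + w \<bullet> w" by (simp add: inner_add_left inner_add_right inner_commute)
  moreover have "0 \<le> e \<bullet> e" "0 \<le> w \<bullet> w" by simp_all
  ultimately have "t * (u \<bullet> w) \<le> e \<bullet> e" by linarith
  moreover have "u \<bullet> w \<le> t * (u \<bullet> w) \<or> u \<bullet> w \<le> 0"
    using t mult_right_mono[of 1 t "u \<bullet> w"] by linarith
  ultimately have "u \<bullet> w \<le> e \<bullet> e" using \<open>0 \<le> e \<bullet> e\<close> by linarith
  then show ?thesis unfolding w_def q_def e_def by (simp add: power2_norm_eq_inner)
qed

text \<open>The ray from y in direction u leaves [-1,2]^d at a point z, and the net point nearest to
  z in the sense of rounding down is projected to G. It differs from z by at most 3/m in each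
  coordinate, and \<open>closest_point_near_support\<close> squares this distance to 9 d / m^2. Here
  u need not be an outer normal of G at y.\<close>

lemma support_net:
  fixes G :: "(real ^ 'd) set"
  assumes G: "convex G" "compact G" "G \<noteq> {}" "G \<subseteq> unit_cube" and m: "m > 0"
  obtains S where "finite S" "S \<subseteq> G" "card S \<le> 2 * CARD('d) * (m + 1) ^ (CARD('d) - 1)"
    "\<And>u y. norm u = 1 \<Longrightarrow> y \<in> G \<Longrightarrow> \<exists>q\<in>S. u \<bullet> (y - q) \<le> 9 * real CARD('d) / (real m)\<^sup>2"
proof -
  let ?p = "\<lambda>b :: real ^ 'd. 3 *\<^sub>R b - 1"
  define S where "S = (\<lambda>b. closest_point G (?p b)) ` grid_boundary m"
  have closed: "closed G" using G by (simp add: compact_imp_closed)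
  show ?thesis
  proof
    show "finite S" unfolding S_def by (intro finite_imageI finite_grid_boundary)
    show "S \<subseteq> G" unfolding S_def using closest_point_in_set[OF closed G(3)] by auto
    show "card S \<le> 2 * CARD('d) * (m + 1) ^ (CARD('d) - 1)" unfolding S_def
      using card_image_le[OF finite_grid_boundary] card_grid_boundary_le order_trans by blast
    fix u y :: "real ^ 'd" assume u: "norm u = 1" and y: "y \<in> G"
    obtain t i where t: "t \<ge> 1" "\<And>j. - 1 \<le> (y + t *\<^sub>R u) $ j" "\<And>j. (y + t *\<^sub>R u) $ j \<le> 2"
      "(y + t *\<^sub>R u) $ i \<in> {- 1, 2}"
      using ray_hits_boundary[OF u] y G(4) by blast
    define z where "z = y + t *\<^sub>R u"
    define b where "b = (1 / 3) *\<^sub>R (z + 1)"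
    have z: "z = ?p b" unfolding b_def by simp
    have "0 \<le> b $ j \<and> b $ j \<le> 1" for j
      using t(2,3)[of j] unfolding b_def z_def[symmetric] by simp
    then have "b \<in> unit_cube" unfolding unit_cube_def by simp
    then have "grid_floor m b \<in> grid m" using m by (simp add: grid_floor_in_grid)
    moreover have "b $ i \<in> {0, 1}" using t(4) unfolding b_def z_def[symmetric] by auto
    \<comment> \<open>Rounding moves the exit point along its face only: the coordinate equal to 0
      or 1 is unchanged.\<close>
    then have "grid_floor m b $ i \<in> {0, 1}" using grid_floor_fixes_01[OF m] by metis
    ultimately have gb: "grid_floor m b \<in> grid_boundary m" unfolding grid_boundary_def by auto
    have "\<bar>(?p (grid_floor m b) - z) $ j\<bar> \<le> 3 * (1 / real m)" for j
      unfolding z using grid_floor_le[OF m, of b j] by (simp add: abs_if split: if_splits)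
    then have "(norm (?p (grid_floor m b) - z))\<^sup>2 \<le> real CARD('d) * (3 * (1 / real m))\<^sup>2"
      by (rule norm_le_coords)
    then have "u \<bullet> (y - closest_point G (?p (grid_floor m b))) \<le> real CARD('d) * (3 * (1 / real m))\<^sup>2"
      using closest_point_near_support[OF G(1) closed y t(1), of u "?p (grid_floor m b)"]
      unfolding z_def by linarith
    also have "\<dots> = 9 * real CARD('d) / (real m)\<^sup>2" by (simp add: power2_eq_square)
    finally show "\<exists>q\<in>S. u \<bullet> (y - q) \<le> 9 * real CARD('d) / (real m)\<^sup>2"
      using gb unfolding S_def by blast
  qed
qed

lemma grid_subset_unit_cube: "grid n \<subseteq> (unit_cube :: (real ^ 'd) set)"
proof
  fix v :: "real ^ 'd" assume v: "v \<in> grid n"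
  have "0 \<le> v $ i \<and> v $ i \<le> 1" for i
  proof -
    obtain k where "k \<le> n" "v $ i = real k / real n" using v unfolding grid_def by blast
    \<comment> \<open>For n = 0 the quotient is 0 by convention.\<close>
    then show ?thesis by (cases "n = 0") auto
  qed
  then show "v \<in> unit_cube" unfolding unit_cube_def by blast
qed

text \<open>Rounding the net costs at most d / n in norm. Rounded points may leave G, so closeness
  has to be shown in both directions.\<close>

lemma grid_hull_approximation:
  fixes G :: "(real ^ 'd) set"
  assumes G: "convex G" "compact G" "G \<noteq> {}" "G \<subseteq> unit_cube" and m: "m > 0" and n: "n > 0"
  defines "\<eta> \<equiv> 9 * real CARD('d) / (real m)\<^sup>2 + real CARD('d) / real n"
  obtains S where "S \<noteq> {}" "S \<subseteq> grid n" "card S \<le> 2 * CARD('d) * (m + 1) ^ (CARD('d) - 1)"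
    "\<And>y. y \<in> G \<Longrightarrow> \<exists>q\<in>convex hull S. dist y q \<le> \<eta>"
    "\<And>q. q \<in> convex hull S \<Longrightarrow> \<exists>y\<in>G. dist q y \<le> \<eta>"
proof -
  obtain S\<^sub>0 where S0: "finite S\<^sub>0" "S\<^sub>0 \<subseteq> G" "card S\<^sub>0 \<le> 2 * CARD('d) * (m + 1) ^ (CARD('d) - 1)"
    "\<And>u y. norm u = 1 \<Longrightarrow> y \<in> G \<Longrightarrow> \<exists>q\<in>S\<^sub>0. u \<bullet> (y - q) \<le> 9 * real CARD('d) / (real m)\<^sup>2"
    using support_net[OF G m] by blast
  define S where "S = grid_floor n ` S\<^sub>0"
  have near: "norm (grid_floor n q - q) \<le> real CARD('d) / real n" for q :: "real ^ 'd"
  proof -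
    have "norm (grid_floor n q - q) \<le> (\<Sum>i\<in>UNIV. \<bar>(grid_floor n q - q) $ i\<bar>)"
      by (rule norm_le_l1_cart)
    also have "\<dots> \<le> (\<Sum>i\<in>(UNIV :: 'd set). 1 / real n)"
      using grid_floor_le[OF n] by (intro sum_mono) simp
    finally show ?thesis by simp
  qed
  have \<eta>: "real CARD('d) / real n \<le> \<eta>" unfolding \<eta>_def by simp
  show ?thesis
  proof
    obtain y\<^sub>0 where "y\<^sub>0 \<in> G" using G(3) by blast
    obtain u :: "real ^ 'd" where "norm u = 1" using vector_choose_size[of 1] by auto
    then have "S\<^sub>0 \<noteq> {}" using S0(4) \<open>y\<^sub>0 \<in> G\<close> by blast
    then show ne: "S \<noteq> {}" unfolding S_def by simp
    show "S \<subseteq> grid n" unfolding S_def using S0(2) G(4) grid_floor_in_grid[OF n] by blast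
    show "card S \<le> 2 * CARD('d) * (m + 1) ^ (CARD('d) - 1)"
      unfolding S_def using card_image_le[OF S0(1)] S0(3) order_trans by blast
    have cl: "closed (convex hull S)" "convex hull S \<noteq> {}"
      using S0(1) ne unfolding S_def by (auto intro!: compact_imp_closed finite_imp_compact_convex_hull)
    show "\<exists>q\<in>convex hull S. dist y q \<le> \<eta>" if y: "y \<in> G" for y
    proof -
      define p where "p = closest_point (convex hull S) y"
      have p: "p \<in> convex hull S" unfolding p_def by (rule closest_point_in_set[OF cl])
      have "dist y p \<le> \<eta>"
      proof (cases "y = p")
        case True
        then show ?thesis unfolding \<eta>_def by simp
      next
        case False
        \<comment> \<open>The normal that separates y from the hull. Along u no point of the hull
          exceeds p, while some rounded net point falls at most eta below y; hence |y - p| <=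
          eta.\<close>
        define u where "u = (1 / norm (y - p)) *\<^sub>R (y - p)"
        have u: "norm u = 1" unfolding u_def using False by simp
        obtain q where q: "q \<in> S\<^sub>0" "u \<bullet> (y - q) \<le> 9 * real CARD('d) / (real m)\<^sup>2"
          using S0(4)[OF u y] by blast
        have "grid_floor n q \<in> convex hull S" using q(1) unfolding S_def by (simp add: hull_inc)
        then have "(y - p) \<bullet> (grid_floor n q - p) \<le> 0"
          unfolding p_def by (intro closest_point_dot cl) auto
        then have a: "u \<bullet> (grid_floor n q - p) \<le> 0"
          unfolding u_def by (simp add: divide_nonpos_nonneg)
        have b: "u \<bullet> (q - grid_floor n q) \<le> real CARD('d) / real n"
          using near[of q] norm_cauchy_schwarz[of u "q - grid_floor n q"] u
          by (simp add: norm_minus_commute)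
        have "dist y p = u \<bullet> (y - p)"
          unfolding u_def using False by (simp add: dist_norm power2_norm_eq_inner[symmetric] power2_eq_square)
        also have "\<dots> = u \<bullet> (y - q) + u \<bullet> (q - grid_floor n q) + u \<bullet> (grid_floor n q - p)"
          by (simp add: inner_diff_right)
        also have "\<dots> \<le> \<eta>" using a b q(2) unfolding \<eta>_def by linarith
        finally show ?thesis .
      qed
      then show ?thesis using p by blast
    qed
    \<comment> \<open>The eta-thickening of G is convex and contains every rounded point, hence
      their whole hull.\<close>
    have conv: "convex (\<Union>x\<in>G. \<Union>w\<in>cball 0 \<eta>. {x + w})"
      using G(1) by (intro convex_sums convex_cball)
    have "S \<subseteq> (\<Union>x\<in>G. \<Union>w\<in>cball 0 \<eta>. {x + w})"
    proof
      fix s assume "s \<in> S"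
      then obtain q where q: "q \<in> S\<^sub>0" "s = grid_floor n q" unfolding S_def by auto
      have "norm (s - q) \<le> \<eta>" using near[of q] \<eta> unfolding q(2) by linarith
      moreover have "s = q + (s - q)" by simp
      ultimately show "s \<in> (\<Union>x\<in>G. \<Union>w\<in>cball 0 \<eta>. {x + w})"
        using S0(2) q(1) by (intro UN_I[of q] UN_I[of "s - q"]) auto
    qed
    then have hull: "convex hull S \<subseteq> (\<Union>x\<in>G. \<Union>w\<in>cball 0 \<eta>. {x + w})"
      using conv by (rule hull_minimal)
    show "\<exists>y\<in>G. dist q y \<le> \<eta>" if "q \<in> convex hull S" for q
      using hull that by (force simp: dist_norm)
  qed
qed

section \<open>Volume of the symmetric difference as a bounded pseudometric\<close>

lemma measure_unit_cube: "measure lborel (unit_cube :: (real ^ 'd) set) = 1"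
proof -
  have "(1 :: real ^ 'd) \<bullet> b = 1" if "b \<in> Basis" for b
    using that by (auto simp: Basis_vec_def inner_axis)
  then show ?thesis unfolding unit_cube_cbox by (subst measure_lborel_cbox) auto
qed

lemma unit_cube_One: "unit_cube = cbox 0 (One :: real ^ 'd)"
proof -
  have "(1 :: real ^ 'd) \<bullet> b = 1" if "b \<in> Basis" for b
    using that by (auto simp: Basis_vec_def inner_axis)
  then show ?thesis unfolding unit_cube_cbox by (auto simp: mem_box)
qed

lemma compact_lborel_fmeasurable:
  fixes K :: "'a::euclidean_space set"
  shows "compact K \<Longrightarrow> K \<in> fmeasurable lborel"
  using emeasure_compact_finite[of K] by (auto simp: fmeasurable_def compact_imp_closed)

lemma sym_diff_fmeasurable:
  fixes A B :: "'a::euclidean_space set"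
  shows "compact A \<Longrightarrow> compact B \<Longrightarrow> sym_diff A B \<in> fmeasurable lborel"
  by (intro fmeasurable.Un fmeasurable.Diff compact_lborel_fmeasurable)

lemma sd_vol_nonneg: "0 \<le> sd_vol A B"
  by (simp add: sd_vol_def)

lemma sd_vol_self [simp]: "sd_vol A A = 0"
  by (simp add: sd_vol_def)

lemma sd_vol_commute: "sd_vol A B = sd_vol B A"
  by (simp add: sd_vol_def Un_commute)

lemma sd_vol_triangle:
  assumes "compact A" "compact B" "compact C"
  shows "sd_vol A C \<le> sd_vol A B + sd_vol B C"
proof -
  have "measure lborel (sym_diff A C) \<le> measure lborel (sym_diff A B \<union> sym_diff B C)"
    using assms by (intro measure_mono_fmeasurable fmeasurableD fmeasurable.Un sym_diff_fmeasurable
        fmeasurable.Diff compact_lborel_fmeasurable) auto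
  also have "\<dots> \<le> measure lborel (sym_diff A B) + measure lborel (sym_diff B C)"
    using assms by (intro measure_Un_le fmeasurableD sym_diff_fmeasurable)
  finally show ?thesis unfolding sd_vol_def .
qed

lemma sd_vol_le_1:
  assumes "compact A" "compact B" "A \<subseteq> unit_cube" "B \<subseteq> unit_cube"
  shows "sd_vol A B \<le> 1"
proof -
  have "measure lborel (sym_diff A B) \<le> measure lborel (unit_cube :: (real ^ 'a) set)"
    using assms
    by (intro measure_mono_fmeasurable fmeasurableD[OF sym_diff_fmeasurable] compact_lborel_fmeasurable)
      (auto simp: unit_cube_cbox)
  then show ?thesis unfolding sd_vol_def measure_unit_cube .
qed

text \<open>Each of \<open>A - B\<close> and \<open>B - A\<close> is a part of a neighborhood minus
  a convex body, which doubles the constant. For eta > 1 the right-hand side exceeds 1 and bounds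
  any symmetric difference inside the cube.\<close>

lemma sd_vol_neighborhood:
  fixes A B :: "(real ^ 'd) set"
  assumes A: "convex A" "compact A" "A \<subseteq> unit_cube" and B: "convex B" "compact B" "B \<subseteq> unit_cube"
    and \<eta>: "0 < \<eta>"
    and AB: "\<And>a. a \<in> A \<Longrightarrow> \<exists>b\<in>B. dist a b \<le> \<eta>" and BA: "\<And>b. b \<in> B \<Longrightarrow> \<exists>a\<in>A. dist b a \<le> \<eta>"
  shows "sd_vol A B \<le> 4 * real CARD('d) * 7 ^ CARD('d) * \<eta>"
proof (cases "\<eta> \<le> 1")
  case True
  have sets: "A \<in> sets lebesgue" "B \<in> sets lebesgue"
    using A B by (auto intro: lmeasurable_compact fmeasurableD)
  have "sd_vol A B \<le> measure lborel (A - B) + measure lborel (B - A)"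
    unfolding sd_vol_def using A B
    by (intro measure_Un_le fmeasurableD fmeasurable.Diff compact_lborel_fmeasurable)
  also have "\<dots> = measure lebesgue (A - B) + measure lebesgue (B - A)"
    using A(2) B(2) by (simp add: compact_imp_closed)
  also have "\<dots> \<le> 2 * real CARD('d) * 7 ^ CARD('d) * \<eta> + 2 * real CARD('d) * 7 ^ CARD('d) * \<eta>"
    using measure_neighborhood_diff[of B \<eta> A] measure_neighborhood_diff[of A \<eta> B] A B \<eta> True AB BA sets
    unfolding unit_cube_One by (intro add_mono) auto
  finally show ?thesis by (simp add: mult_ac)
next
  case False
  have "0 < CARD('d)" by simp
  then have "1 \<le> 4 * real CARD('d)" by linarith
  then have "1 * 1 * 1 \<le> 4 * real CARD('d) * 7 ^ CARD('d) * \<eta>"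
    using False by (intro mult_mono) auto
  then show ?thesis using sd_vol_le_1[OF A(2) B(2) A(3) B(3)] by linarith
qed

section \<open>Grid polytopes close to a convex body\<close>

lemma polytope_classD:
  assumes "P \<in> polytope_class r"
  shows "convex P" "compact P" "P \<subseteq> unit_cube" "polytope P"
  using assms by (auto simp: polytope_class_def polytope_imp_convex polytope_imp_compact)

lemma grid_polytope_classD:
  assumes "P \<in> grid_polytope_class n r"
  shows "convex P" "compact P" "P \<subseteq> unit_cube" "polytope P"
  using assms polytope_classD[of P r] by (auto simp: grid_polytope_class_def)

lemma shape_class_subset_convex_class: "shape_class r \<subseteq> convex_class"
  by (auto simp: shape_class_def polytope_class_def convex_class_def polytope_imp_convex
      polytope_imp_compact split: enat.splits)

lemma polytope_class_mono: "r \<le> s \<Longrightarrow> polytope_class r \<subseteq> polytope_class s"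
  by (auto simp: polytope_class_def)

lemma convex_hull_in_grid_polytope_class:
  assumes S: "S \<subseteq> grid n" "card S \<le> r" and int: "interior (convex hull S) \<noteq> {}"
  shows "convex hull S \<in> grid_polytope_class n r"
proof -
  have fin: "finite S" using S(1) finite_grid by (rule finite_subset)
  have ext: "v \<in> S" if "v extreme_point_of (convex hull S)" for v
    using that by (rule extreme_point_of_convex_hull)
  have "convex hull S \<subseteq> unit_cube"
    using S(1) grid_subset_unit_cube by (intro hull_minimal convex_unit_cube) auto
  moreover have "card {v. v extreme_point_of (convex hull S)} \<le> r"
    using card_mono[OF fin, of "{v. v extreme_point_of (convex hull S)}"] ext S(2) by force
  moreover have "polytope (convex hull S)" using fin unfolding polytope_def by blast
  moreover have "\<exists>k::int. v $ i = of_int k / real n" if "v extreme_point_of (convex hull S)" for v i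
  proof -
    have "v \<in> grid n" using ext[OF that] S(1) by blast
    then obtain k where "v $ i = real k / real n" unfolding grid_def by blast
    then show ?thesis by (intro exI[of _ "int k"]) simp
  qed
  ultimately show ?thesis unfolding grid_polytope_class_def polytope_class_def using int by blast
qed

text \<open>The standard simplex scaled by 1/n. It serves as a substitute when a hull of grid points
  is flat, since members of the class must have nonempty interior, and as an arbitrary witness that
  the class is nonempty.\<close>

lemma small_grid_simplex:
  assumes n: "n > 0" and r: "CARD('d) + 1 \<le> r"
  obtains Q :: "(real ^ 'd) set" where "Q \<in> grid_polytope_class n r" "measure lborel Q \<le> 1 / real n"
proof -
  define f where "f = (\<lambda>v :: real ^ 'd. (1 / real n) *\<^sub>R v)"
  define S where "S = f ` insert 0 Basis"
  have lin: "linear f" unfolding f_def by (rule linear_scaleR)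
  have "inj f" unfolding f_def using n by (auto intro!: injI)
  have hull: "convex hull S = f ` (convex hull insert 0 Basis)"
    unfolding S_def by (rule convex_hull_linear_image[OF lin, symmetric])
  have "interior (convex hull (insert 0 (Basis :: (real ^ 'd) set))) \<noteq> {}"
    using interior_std_simplex_nonempty by blast
  then have int: "interior (convex hull S) \<noteq> {}"
    unfolding hull interior_injective_linear_image[OF lin \<open>inj f\<close>] by simp
  have coord: "(v :: real ^ 'd) $ i \<in> {0, 1}" if "v \<in> insert 0 Basis" for v i
    using that by (auto simp: Basis_vec_def axis_def)
  have box: "f v $ i \<in> {0, 1 / real n}" if "v \<in> insert 0 Basis" for v i
    using coord[OF that, of i] unfolding f_def by auto
  have "S \<subseteq> grid n"
  proof
    fix s assume "s \<in> S"
    then have s: "s $ i \<in> {0, 1 / real n}" for i unfolding S_def using box by blast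
    have "\<exists>k\<le>n. s $ i = real k / real n" for i
    proof (cases "s $ i = 0")
      case True
      then show ?thesis by (intro exI[of _ 0]) simp
    next
      case False
      then show ?thesis using s[of i] n by (intro exI[of _ 1]) simp
    qed
    then show "s \<in> grid n" unfolding grid_def by blast
  qed
  moreover have "card S \<le> r"
  proof -
    have "card S \<le> card (insert 0 (Basis :: (real ^ 'd) set))" unfolding S_def by (rule card_image_le) simp
    also have "\<dots> \<le> CARD('d) + 1" by (simp add: card_insert_if)
    finally show ?thesis using r by simp
  qed
  ultimately have cls: "convex hull S \<in> grid_polytope_class n r"
    using int by (intro convex_hull_in_grid_polytope_class)
  let ?B = "cbox 0 (f 1)"
  have "S \<subseteq> ?B"
  proof
    fix s assume "s \<in> S"
    then have s: "s $ i \<in> {0, 1 / real n}" for i unfolding S_def using box by blast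
    have "0 \<le> s $ i \<and> s $ i \<le> 1 / real n" for i using s[of i] by auto
    then show "s \<in> ?B" unfolding f_def by (simp add: mem_box_cart)
  qed
  then have sub: "convex hull S \<subseteq> ?B" by (intro hull_minimal convex_box)
  have "(f 1) \<bullet> b = 1 / real n" if "b \<in> Basis" for b
    using that unfolding f_def by (auto simp: Basis_vec_def inner_axis)
  then have "measure lborel ?B = (1 / real n) ^ CARD('d)"
    by (subst measure_lborel_cbox) auto
  also have "\<dots> \<le> 1 / real n"
    using power_decreasing[of 1 "CARD('d)" "1 / real n"] n by (simp add: Suc_leI)
  finally have "measure lborel ?B \<le> 1 / real n" .
  moreover have "measure lborel (convex hull S) \<le> measure lborel ?B"
    using sub grid_polytope_classD(2)[OF cls]
    by (intro measure_mono_fmeasurable fmeasurableD compact_lborel_fmeasurable) auto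
  ultimately show ?thesis using cls that by force
qed

lemma grid_polytope_approximation:
  fixes G :: "(real ^ 'd) set"
  assumes G: "G \<in> convex_class" and m: "m > 0" and n: "n > 0"
    and r: "2 * CARD('d) * (m + 1) ^ (CARD('d) - 1) \<le> r" "CARD('d) + 1 \<le> r"
  defines "\<eta> \<equiv> 9 * real CARD('d) / (real m)\<^sup>2 + real CARD('d) / real n"
  obtains Q where "Q \<in> grid_polytope_class n r"
    "sd_vol Q G \<le> 4 * real CARD('d) * 7 ^ CARD('d) * \<eta> + 1 / real n"
proof -
  have G': "convex G" "compact G" "G \<noteq> {}" "G \<subseteq> unit_cube"
    using G interior_subset[of G] unfolding convex_class_def by auto
  obtain S where S: "S \<noteq> {}" "S \<subseteq> grid n" "card S \<le> 2 * CARD('d) * (m + 1) ^ (CARD('d) - 1)"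
    "\<And>y. y \<in> G \<Longrightarrow> \<exists>q\<in>convex hull S. dist y q \<le> \<eta>"
    "\<And>q. q \<in> convex hull S \<Longrightarrow> \<exists>y\<in>G. dist q y \<le> \<eta>"
    using grid_hull_approximation[OF G' m n] unfolding \<eta>_def by blast
  let ?H = "convex hull S"
  have fin: "finite S" using S(2) finite_grid by (rule finite_subset)
  have "S \<subseteq> unit_cube" using S(2) grid_subset_unit_cube by blast
  then have H: "convex ?H" "compact ?H" "?H \<subseteq> unit_cube"
    using fin by (simp_all add: hull_minimal convex_unit_cube finite_imp_compact_convex_hull)
  have "\<eta> > 0" unfolding \<eta>_def using m n by (intro add_pos_pos divide_pos_pos) auto
  then have HG: "sd_vol ?H G \<le> 4 * real CARD('d) * 7 ^ CARD('d) * \<eta>"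
    using sd_vol_neighborhood[OF H G'(1,2,4)] S(4,5) by blast
  show ?thesis
  proof (cases "interior ?H = {}")
    case False
    then have "?H \<in> grid_polytope_class n r"
      using S(2,3) r(1) by (intro convex_hull_in_grid_polytope_class) auto
    then show ?thesis using that HG by (smt (verit) divide_nonneg_nonneg of_nat_0_le_iff)
  next
    \<comment> \<open>A flat hull has volume 0, so G itself is small, and the tiny simplex does
      equally well up to its own volume 1/n.\<close>
    case True
    obtain Q :: "(real ^ 'd) set" where Q: "Q \<in> grid_polytope_class n r" "measure lborel Q \<le> 1 / real n"
      using small_grid_simplex[OF n r(2)] by blast
    have "negligible ?H" using True H(1) by (simp add: negligible_convex_interior)
    then have H0: "measure lborel ?H = 0"
      using H(2) negligible_imp_measure0 by (fastforce simp: compact_imp_closed)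
    have Qc: "compact Q" using grid_polytope_classD[OF Q(1)] by simp
    have "sd_vol Q G \<le> sd_vol Q {} + sd_vol {} ?H + sd_vol ?H G"
      using sd_vol_triangle[OF Qc _ G'(2), of "{}"] sd_vol_triangle[of "{}" ?H G] H(2) G'(2) by simp
    also have "\<dots> \<le> 1 / real n + 4 * real CARD('d) * 7 ^ CARD('d) * \<eta>"
      using Q(2) H0 HG by (simp add: sd_vol_def)
    finally show ?thesis using that Q(1) by (simp add: add.commute)
  qed
qed

section \<open>Where the two terms of the rate cross\<close>

context
  fixes n :: nat and \<tau> :: real
  assumes n: "2 \<le> n"
  defines "\<tau> \<equiv> ln (real n) / real n"
begin

lemma log_ratio_bounds: "0 < \<tau>" "\<tau> \<le> 1" "1 / real n \<le> 2 * \<tau>"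
proof -
  have "ln 2 \<le> ln (real n)" using n by simp
  then have ln: "1 / 2 \<le> ln (real n)" using ln2_ge_two_thirds by linarith
  show "0 < \<tau>" using n unfolding \<tau>_def by simp
  show "\<tau> \<le> 1" using n ln_le_minus_one[of "real n"] unfolding \<tau>_def by simp
  show "1 / real n \<le> 2 * \<tau>" using n ln unfolding \<tau>_def by (simp add: divide_simps)
qed

lemma rate_infinity: "rate d n \<infinity> = \<tau> powr (2 / (real d + 1))"
  by (simp add: rate_def \<tau>_def)

lemma rate_enat: "rate d n (enat k) = min (real k * \<tau>) (rate d n \<infinity>)"
  by (simp add: rate_def \<tau>_def)

lemma R_max_eq: "R_max d n = nat \<lfloor>(1 / \<tau>) powr ((real d - 1) / (real d + 1))\<rfloor>"
  by (simp add: R_max_def \<tau>_def)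

lemma rate_infinity_pos: "0 < rate d n \<infinity>"
  using log_ratio_bounds by (simp add: rate_infinity)

lemma log_ratio_le_rate_infinity:
  assumes "2 \<le> d" shows "\<tau> \<le> rate d n \<infinity>"
  using powr_mono'[of "2 / (real d + 1)" 1 \<tau>] log_ratio_bounds assms by (simp add: rate_infinity)

text \<open>The exponents satisfy 1 - (d-1)/(d+1) = 2/(d+1). The cutoff before taking the integer
  part is thus the value of r at which both terms of the minimum agree, and comparing r with
  \<open>R_max\<close> decides which one is active.\<close>

lemma R_max_balance: "(1 / \<tau>) powr ((real d - 1) / (real d + 1)) * \<tau> = rate d n \<infinity>"
proof -
  have "(1 / \<tau>) powr ((real d - 1) / (real d + 1)) = \<tau> powr (- ((real d - 1) / (real d + 1)))"
    using log_ratio_bounds by (simp add: powr_minus_divide powr_divide)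
  also have "\<dots> * \<tau> = \<tau> powr (- ((real d - 1) / (real d + 1)) + 1)"
    using log_ratio_bounds powr_mult_base[of \<tau> "- ((real d - 1) / (real d + 1))"]
    by (simp add: mult.commute add.commute)
  also have "- ((real d - 1) / (real d + 1)) + 1 = 2 / (real d + 1)" by (simp add: field_simps)
  finally show ?thesis by (simp add: rate_infinity)
qed

lemma R_max_log_ratio_le: "real (R_max d n) * \<tau> \<le> rate d n \<infinity>"
proof -
  have "real (R_max d n) \<le> (1 / \<tau>) powr ((real d - 1) / (real d + 1))"
    unfolding R_max_eq by (simp add: floor_le_iff of_nat_nat)
  then show ?thesis using log_ratio_bounds R_max_balance[of d] mult_right_mono[of _ _ \<tau>] by fastforce
qed

lemma rate_le_R_max: "k \<le> R_max d n \<Longrightarrow> rate d n (enat k) = real k * \<tau>"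
  using R_max_log_ratio_le[of d] log_ratio_bounds mult_right_mono[of "real k" "real (R_max d n)" \<tau>]
  unfolding rate_enat by linarith

lemma rate_gt_R_max:
  assumes "R_max d n < k" shows "rate d n (enat k) = rate d n \<infinity>"
proof -
  have "(1 / \<tau>) powr ((real d - 1) / (real d + 1)) \<le> real k"
    using assms unfolding R_max_eq by linarith
  then show ?thesis
    using log_ratio_bounds R_max_balance[of d] mult_right_mono[of _ "real k" \<tau>] unfolding rate_enat by fastforce
qed

text \<open>Crude, but enough for a union over at most 2 R_n failure events of probability O(1/n^2)
  each.\<close>

lemma R_max_le: "real (R_max d n) \<le> 2 * real n"
proof -
  have "real (R_max d n) * \<tau> \<le> 1"
    using R_max_log_ratio_le[of d] log_ratio_bounds powr_le1[of "2 / (real d + 1)" \<tau>]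
    unfolding rate_infinity by simp
  then have "real (R_max d n) \<le> 1 / \<tau>" using log_ratio_bounds by (simp add: field_simps)
  also have "1 / \<tau> \<le> 2 * real n"
    using log_ratio_bounds n by (simp add: field_simps)
  finally show ?thesis .
qed

end

text \<open>Choice of the mesh: m is proportional to x = (n / ln n)^(1/(d+1)), small enough for the
  hull to have at most R_n vertices and large enough for the error 1/m^2 to be of order
  x^(-2).\<close>

lemma grid_polytope_approximation_rate:
  assumes d: "2 \<le> CARD('d::finite)"
  obtains C where "0 < C" "\<And>n G. 2 \<le> n \<Longrightarrow> CARD('d) + 1 \<le> R_max CARD('d) n \<Longrightarrow> G \<in> convex_class \<Longrightarrow>
     \<exists>Q \<in> grid_polytope_class n (R_max CARD('d) n). sd_vol Q (G :: (real ^ 'd) set) \<le> C * rate CARD('d) n \<infinity>"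
proof -
  define D where "D = real CARD('d)"
  have D: "D \<ge> 2" using d unfolding D_def by linarith
  define V where "V = 4 * D * 7 ^ CARD('d)"
  \<comment> \<open>The first term comes from the approximation error, the 2 from the volume 1/n of
    the substitute simplex, and \<open>16 * D\<^sup>2\<close> from the case of small x, where no
    mesh is available.\<close>
  define C where "C = V * (576 * D ^ 3 + 2 * D) + 2 + 16 * D\<^sup>2"
  have V: "V > 0" unfolding V_def using D by simp
  have C: "C > 0" unfolding C_def using D V by (intro add_nonneg_pos add_pos_nonneg mult_nonneg_nonneg add_nonneg_nonneg) auto
  have "\<exists>Q \<in> grid_polytope_class n (R_max CARD('d) n). sd_vol Q G \<le> C * rate CARD('d) n \<infinity>"
    if n: "2 \<le> n" and R: "CARD('d) + 1 \<le> R_max CARD('d) n" and G: "G \<in> convex_class" for n and G :: "(real ^ 'd) set"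
  proof -
    define t where "t = ln (real n) / real n"
    let ?\<rho> = "rate CARD('d) n \<infinity>"
    define x where "x = (1 / t) powr (1 / (D + 1))"
    have \<tau>: "0 < t" unfolding t_def by (rule log_ratio_bounds(1)[OF n])
    have x0: "0 < x" unfolding x_def using \<tau> by simp
    have x2: "?\<rho> = 1 / x\<^sup>2"
    proof -
      have "x\<^sup>2 = x powr 2" using x0 by (simp add: powr_numeral)
      also have "\<dots> = (1 / t) powr (2 / (D + 1))" unfolding x_def powr_powr by simp
      also have "\<dots> = 1 / ?\<rho>" using \<tau> unfolding rate_infinity[OF n, folded t_def] D_def by (simp add: powr_divide)
      finally show ?thesis by simp
    qed
    have xd: "x ^ (CARD('d) - 1) = (1 / t) powr ((D - 1) / (D + 1))"
    proof -
      have "x ^ (CARD('d) - 1) = x powr (D - 1)"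
        using x0 d by (simp add: powr_realpow[symmetric] D_def of_nat_diff)
      then show ?thesis unfolding x_def powr_powr by simp
    qed
    have Gc: "compact G" "G \<subseteq> unit_cube" using G unfolding convex_class_def by auto
    have \<rho>0: "?\<rho> \<ge> 0" using rate_infinity_pos[OF n, of "CARD('d)"] by simp
    show ?thesis
    proof (cases "4 * D \<le> x")
      case True
      \<comment> \<open>Since m + 1 <= 2 m <= x / (2 D), the vertex bound 2 D (m + 1)^(d-1) is at
        most 2 D (x / (2 D))^(d-1), which is at most x^(d-1) because the exponent is at least
        1.\<close>
      define m where "m = nat \<lfloor>x / (4 * D)\<rfloor>"
      have x1: "1 \<le> x / (4 * D)" using True D by simp
      then have m: "m > 0" "real m \<le> x / (4 * D)" "x / (4 * D) < real m + 1"
        unfolding m_def by linarith+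
      have "real (2 * CARD('d) * (m + 1) ^ (CARD('d) - 1)) = 2 * D * (real m + 1) ^ (CARD('d) - 1)"
        unfolding D_def by (simp add: add.commute)
      also have "\<dots> \<le> 2 * D * (x / (2 * D)) ^ (CARD('d) - 1)"
      proof (intro mult_left_mono power_mono)
        have "real m + 1 \<le> 2 * real m" using m by simp
        also have "\<dots> \<le> 2 * (x / (4 * D))" using m by simp
        finally show "real m + 1 \<le> x / (2 * D)" by simp
      qed (use D in auto)
      also have "\<dots> = 2 * D * x ^ (CARD('d) - 1) / (2 * D) ^ (CARD('d) - 1)" by (simp add: power_divide)
      also have "\<dots> \<le> 2 * D * x ^ (CARD('d) - 1) / (2 * D) ^ 1"
        using D x0 d by (intro divide_left_mono power_increasing) auto
      also have "\<dots> = (1 / t) powr ((D - 1) / (D + 1))" using xd D by simp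
      finally have mR: "2 * CARD('d) * (m + 1) ^ (CARD('d) - 1) \<le> R_max CARD('d) n"
        unfolding R_max_eq[OF n, folded t_def] D_def by (simp add: le_nat_floor)
      have "n > 0" using n by simp
      obtain Q where Q: "Q \<in> grid_polytope_class n (R_max CARD('d) n)"
        "sd_vol Q G \<le> V * (9 * D / (real m)\<^sup>2 + D / real n) + 1 / real n"
        using grid_polytope_approximation[OF G m(1) \<open>n > 0\<close> mR R] unfolding V_def D_def .
      have inv: "1 / real n \<le> 2 * ?\<rho>"
        using log_ratio_bounds(3)[OF n] log_ratio_le_rate_infinity[OF n d] by linarith
      \<comment> \<open>From x / (4 D) < m + 1 <= 2 m follows m >= x / (8 D), so 9 D / m^2 is at
        most 9 D (8 D)^2 / x^2. This is the origin of 576.\<close>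
      have "x / (8 * D) = x / (4 * D) / 2" by simp
      moreover have "1 \<le> real m" using m(1) by simp
      ultimately have "x / (8 * D) \<le> real m" using m(3) by linarith
      then have "(x / (8 * D))\<^sup>2 \<le> (real m)\<^sup>2" using x0 D by (intro power_mono) auto
      then have "9 * D / (real m)\<^sup>2 \<le> 9 * D / (x / (8 * D))\<^sup>2"
        using x0 D m by (intro divide_left_mono) auto
      also have "\<dots> = 576 * D ^ 3 * ?\<rho>" unfolding x2 using x0 D by (simp add: power2_eq_square power3_eq_cube)
      finally have "9 * D / (real m)\<^sup>2 + D / real n \<le> 576 * D ^ 3 * ?\<rho> + D * (2 * ?\<rho>)"
        using inv D mult_left_mono[OF inv, of D] by simp
      then have "V * (9 * D / (real m)\<^sup>2 + D / real n) \<le> V * (576 * D ^ 3 * ?\<rho> + D * (2 * ?\<rho>))"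
        using V by simp
      with Q(2) inv have "sd_vol Q G \<le> V * (576 * D ^ 3 * ?\<rho> + D * (2 * ?\<rho>)) + 2 * ?\<rho>" by linarith
      also have "\<dots> \<le> C * ?\<rho>" unfolding C_def using \<rho>0 by (simp add: algebra_simps)
      finally show ?thesis using Q(1) by blast
    next
      \<comment> \<open>Here x is bounded, so the rate 1 / x^2 is bounded below and any grid
        polytope is good enough.\<close>
      case False
      obtain Q :: "(real ^ 'd) set" where Q: "Q \<in> grid_polytope_class n (R_max CARD('d) n)"
        using small_grid_simplex[OF _ R, of n] n by auto
      have "x\<^sup>2 \<le> (4 * D)\<^sup>2" using False x0 by (intro power_mono) auto
      then have "1 \<le> 16 * D\<^sup>2 * ?\<rho>" unfolding x2 using x0 by (simp add: power_mult_distrib)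
      also have "\<dots> \<le> C * ?\<rho>" unfolding C_def using V D \<rho>0 by (intro mult_right_mono) auto
      finally show ?thesis
        using Q sd_vol_le_1[OF grid_polytope_classD(2)[OF Q] Gc(1) grid_polytope_classD(3)[OF Q] Gc(2)]
        by (intro bexI[of _ Q]) auto
    qed
  qed
  with C that show ?thesis by blast
qed

section \<open>Risk of the contrast minimizer at a convex set\<close>

lemma emeasure_unit_cube: "emeasure lborel (unit_cube :: (real ^ 'd) set) = 1"
proof -
  have "(unit_cube :: (real ^ 'd) set) \<in> fmeasurable lborel"
    unfolding unit_cube_cbox by (intro compact_lborel_fmeasurable compact_cbox)
  then show ?thesis by (simp add: emeasure_eq_measure2 measure_unit_cube)
qed

lemma prob_space_uniform_unit_cube: "prob_space (uniform_measure lborel (unit_cube :: (real ^ 'd) set))"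
  by (rule prob_space_uniform_measure) (simp_all add: emeasure_unit_cube)

lemma measure_uniform_unit_cube:
  assumes "A \<in> sets borel" "A \<subseteq> unit_cube"
  shows "measure (uniform_measure lborel (unit_cube :: (real ^ 'd) set)) A = measure lborel A"
proof -
  have "(unit_cube :: (real ^ 'd) set) \<in> sets lborel" unfolding unit_cube_cbox by simp
  moreover have "unit_cube \<inter> A = A" using assms by auto
  ultimately show ?thesis using assms
    by (simp add: measure_def divide_ennreal_def emeasure_unit_cube)
qed

section \<open>Exponential moments of contrast differences\<close>

context
  fixes \<sigma> :: real and \<nu> :: "real measure" and G :: "(real ^ 'd) set"
  assumes \<nu>: "subgaussian_law \<sigma> \<nu>" and G: "compact G"
begin

lemma sets_noise [measurable_cong]: "sets \<nu> = sets borel"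
  using \<nu> unfolding subgaussian_law_def by blast

lemma prob_space_noise: "prob_space \<nu>"
  using \<nu> unfolding subgaussian_law_def by blast

lemma compact_borel [measurable]: "G \<in> sets borel"
  using G by (simp add: compact_imp_closed)

lemma sets_obs_law: "sets (obs_law \<nu> G) = sets (borel \<Otimes>\<^sub>M borel)"
  by (simp add: obs_law_def)

lemma measurable_obs:
  "(\<lambda>(x, e). (x, indicator G x + e)) \<in> uniform_measure lborel unit_cube \<Otimes>\<^sub>M \<nu> \<rightarrow>\<^sub>M borel \<Otimes>\<^sub>M borel"
  by measurable

lemma prob_space_obs_law: "prob_space (obs_law \<nu> G)"
proof -
  interpret N: prob_space \<nu> by (rule prob_space_noise)
  interpret U: prob_space "uniform_measure lborel (unit_cube :: (real ^ 'd) set)"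
    by (rule prob_space_uniform_unit_cube)
  interpret pair_prob_space "uniform_measure lborel (unit_cube :: (real ^ 'd) set)" \<nu> ..
  show ?thesis unfolding obs_law_def by (rule prob_space_distr[OF measurable_obs])
qed

lemma prob_space_sample_law: "prob_space (sample_law n \<nu> G)"
  unfolding sample_law_def by (intro prob_space_PiM prob_space_obs_law)

lemma sets_sample_law: "sets (sample_law n \<nu> G) = sets (PiM {..<n} (\<lambda>_. borel \<Otimes>\<^sub>M borel))"
  unfolding sample_law_def by (intro sets_PiM_cong sets_obs_law refl)

lemma space_sample_law: "space (sample_law n \<nu> G) = space (PiM {..<n} (\<lambda>_. borel \<Otimes>\<^sub>M borel))"
  by (rule sets_eq_imp_space_eq[OF sets_sample_law])

lemma nn_integral_noise_exp: "(\<integral>\<^sup>+ e. ennreal (exp (u * e)) \<partial>\<nu>) \<le> ennreal (exp (u\<^sup>2 * \<sigma>\<^sup>2 / 2))"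
proof -
  have "integrable \<nu> (\<lambda>x. exp (u * x))" "(\<integral>x. exp (u * x) \<partial>\<nu>) \<le> exp (u\<^sup>2 * \<sigma>\<^sup>2 / 2)"
    using \<nu> unfolding subgaussian_law_def by blast+
  then show ?thesis by (simp add: nn_integral_eq_integral ennreal_leI)
qed

(* With l = 2 k and k = 1 / (8 \<sigma>^2), the noise contributes exp (2 l^2 \<sigma>^2) = exp k on the
   symmetric difference of P and Q, so the exponents there are l + k and k - l. *)
lemma obs_law_exp_contrast:
  assumes \<sigma>: "0 < \<sigma>" and P: "compact P" and Q: "compact Q"
    and sub: "P \<subseteq> unit_cube" "Q \<subseteq> unit_cube" "G \<subseteq> unit_cube"
  defines "k \<equiv> 1 / (8 * \<sigma>\<^sup>2)"
  shows "(\<integral>\<^sup>+ z. ennreal (exp (2 * k * ((1 - 2 * snd z) * (indicator Q (fst z) - indicator P (fst z))))) \<partial>obs_law \<nu> G)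
    \<le> ennreal (exp ((exp (3 * k) - exp (- k)) * sd_vol Q G - (1 - exp (- k)) * sd_vol P G))"
proof -
  interpret N: prob_space \<nu> by (rule prob_space_noise)
  interpret U: prob_space "uniform_measure lborel (unit_cube :: (real ^ 'd) set)"
    by (rule prob_space_uniform_unit_cube)
  let ?U = "uniform_measure lborel (unit_cube :: (real ^ 'd) set)"
  have [measurable]: "P \<in> sets borel" "Q \<in> sets borel" using P Q by (auto simp: compact_imp_closed)
  have k0: "0 < k" using \<sigma> unfolding k_def by simp
  define s where "s = (\<lambda>x :: real ^ 'd. indicator Q x - indicator P x :: real)"
  define a where "a = exp (3 * k) - exp (- k)"
  define b where "b = 1 - exp (- k)"
  have b: "0 < b" "b < 1" unfolding b_def using k0 by auto
  have a: "a \<ge> 0" unfolding a_def using k0 by simp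
  \<comment> \<open>A pointwise majorant of the exponential moment given the design point. Where P
    and Q differ and P is wrong about G, it equals exp(-k); where Q is wrong, it is 1 + a >= exp(3
    k). Where P and Q agree the moment is 1, and h is 1 if both are right and 1 + a - b = exp(3 k)
    if both are wrong.\<close>
  define h where "h = (\<lambda>x. 1 + a * indicator (sym_diff Q G) x - b * indicator (sym_diff P G) x :: real)"
  have h0: "0 \<le> h x" for x unfolding h_def using a b by (auto simp: indicator_def)
  have ind: "integrable ?U (indicator (sym_diff A G) :: _ \<Rightarrow> real)" if [measurable]: "A \<in> sets borel" for A
    by (intro integrable_real_indicator) (auto simp: U.emeasure_eq_measure)
  have h_int: "integrable ?U h"
    unfolding h_def
    by (intro Bochner_Integration.integrable_diff Bochner_Integration.integrable_add integrable_mult_right ind) auto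
  have inner: "(\<integral>\<^sup>+ e. ennreal (exp (2 * k * ((1 - 2 * (indicator G x + e)) * s x))) \<partial>\<nu>) \<le> ennreal (h x)" for x
  proof -
    have "(\<integral>\<^sup>+ e. ennreal (exp (2 * k * ((1 - 2 * (indicator G x + e)) * s x))) \<partial>\<nu>)
      = (\<integral>\<^sup>+ e. ennreal (exp (2 * k * (1 - 2 * indicator G x) * s x)) * ennreal (exp (- 4 * k * s x * e)) \<partial>\<nu>)"
      by (intro nn_integral_cong) (simp add: ennreal_mult[symmetric] exp_add[symmetric] algebra_simps)
    also have "\<dots> = ennreal (exp (2 * k * (1 - 2 * indicator G x) * s x)) * (\<integral>\<^sup>+ e. ennreal (exp (- 4 * k * s x * e)) \<partial>\<nu>)"
      by (rule nn_integral_cmult) measurable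
    also have "\<dots> \<le> ennreal (exp (2 * k * (1 - 2 * indicator G x) * s x)) * ennreal (exp ((- 4 * k * s x)\<^sup>2 * \<sigma>\<^sup>2 / 2))"
      by (intro mult_left_mono nn_integral_noise_exp) simp
    also have "\<dots> = ennreal (exp (2 * k * (1 - 2 * indicator G x) * s x + k * (s x)\<^sup>2))"
    proof -
      have "(- 4 * k * s x)\<^sup>2 * \<sigma>\<^sup>2 / 2 = k * (s x)\<^sup>2"
        using \<sigma> unfolding k_def by (simp add: power2_eq_square field_simps)
      then show ?thesis by (simp add: ennreal_mult[symmetric] exp_add[symmetric])
    qed
    also have "\<dots> \<le> ennreal (h x)"
      using b a unfolding h_def s_def a_def b_def
      by (intro ennreal_leI) (auto simp: indicator_def algebra_simps split: if_splits)
    finally show ?thesis .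
  qed
  have meas: "(\<lambda>z. ennreal (exp (2 * k * ((1 - 2 * (indicator G (fst z) + snd z)) * s (fst z)))))
      \<in> borel_measurable (?U \<Otimes>\<^sub>M \<nu>)"
    unfolding s_def by measurable
  have "(\<integral>\<^sup>+ z. ennreal (exp (2 * k * ((1 - 2 * snd z) * (indicator Q (fst z) - indicator P (fst z))))) \<partial>obs_law \<nu> G)
    = (\<integral>\<^sup>+ z. ennreal (exp (2 * k * ((1 - 2 * (indicator G (fst z) + snd z)) * s (fst z)))) \<partial>(?U \<Otimes>\<^sub>M \<nu>))"
    unfolding obs_law_def s_def
    by (subst nn_integral_distr[OF measurable_obs]) (measurable, simp add: case_prod_unfold)
  also have "\<dots> = (\<integral>\<^sup>+ x. \<integral>\<^sup>+ e. ennreal (exp (2 * k * ((1 - 2 * (indicator G x + e)) * s x))) \<partial>\<nu> \<partial>?U)"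
    using N.nn_integral_fst[OF meas] by simp
  also have "\<dots> \<le> (\<integral>\<^sup>+ x. ennreal (h x) \<partial>?U)"
    by (intro nn_integral_mono inner)
  also have "\<dots> = ennreal (\<integral> x. h x \<partial>?U)"
    using h_int h0 by (intro nn_integral_eq_integral AE_I2)
  also have "(\<integral> x. h x \<partial>?U) = 1 + a * measure ?U (sym_diff Q G) - b * measure ?U (sym_diff P G)"
    unfolding h_def using ind[of Q] ind[of P] U.prob_space by simp
  also have "\<dots> = 1 + (a * sd_vol Q G - b * sd_vol P G)"
    unfolding sd_vol_def using sub by (subst (1 2) measure_uniform_unit_cube) auto
  \<comment> \<open>Passing to the exponential makes the bound multiplicative, so n independent
    pairs just multiply the exponent by n.\<close>
  also have "ennreal \<dots> \<le> ennreal (exp (a * sd_vol Q G - b * sd_vol P G))"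
    by (intro ennreal_leI exp_ge_add_one_self)
  finally show ?thesis unfolding a_def b_def .
qed

lemma contrast_comparison_sets:
  assumes "compact P" "compact Q"
  shows "{\<omega> \<in> space (sample_law n \<nu> G). contrast n \<omega> P \<le> contrast n \<omega> Q} \<in> sets (sample_law n \<nu> G)"
proof -
  have [measurable]: "P \<in> sets borel" "Q \<in> sets borel" using assms by (auto simp: compact_imp_closed)
  show ?thesis unfolding contrast_def sets_sample_law space_sample_law by measurable
qed

text \<open>Chernoff bound with tilt 2 k > 0: on the event the exponential of 2 k times the contrast
  difference is at least 1, and its expectation factorizes over the independent pairs.\<close>

lemma contrast_comparison_tail:
  assumes \<sigma>: "0 < \<sigma>" and P: "compact P" and Q: "compact Q"
    and sub: "P \<subseteq> unit_cube" "Q \<subseteq> unit_cube" "G \<subseteq> unit_cube"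
  defines "k \<equiv> 1 / (8 * \<sigma>\<^sup>2)"
  shows "emeasure (sample_law n \<nu> G) {\<omega> \<in> space (sample_law n \<nu> G). contrast n \<omega> P \<le> contrast n \<omega> Q}
    \<le> ennreal (exp (real n * ((exp (3 * k) - exp (- k)) * sd_vol Q G - (1 - exp (- k)) * sd_vol P G)))"
proof -
  interpret O: prob_space "obs_law \<nu> G" by (rule prob_space_obs_law)
  interpret product_sigma_finite "\<lambda>_ :: nat. obs_law \<nu> G" ..
  let ?M = "sample_law n \<nu> G"
  let ?f = "\<lambda>z :: (real ^ 'd) \<times> real. exp (2 * k * ((1 - 2 * snd z) * (indicator Q (fst z) - indicator P (fst z))))"
  let ?A = "{\<omega> \<in> space ?M. contrast n \<omega> P \<le> contrast n \<omega> Q}"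
  have [measurable]: "P \<in> sets borel" "Q \<in> sets borel" using P Q by (auto simp: compact_imp_closed)
  have k0: "0 < k" using \<sigma> unfolding k_def by simp
  have f: "?f \<in> borel_measurable (obs_law \<nu> G)"
    unfolding measurable_cong_sets[OF sets_obs_law refl] by measurable
  have eq: "(\<Prod>i<n. ?f (\<omega> i)) = exp (2 * k * (contrast n \<omega> Q - contrast n \<omega> P))" for \<omega>
    unfolding contrast_def by (simp add: exp_sum[symmetric] sum_distrib_left sum_subtractf[symmetric] algebra_simps)
  have "emeasure ?M ?A = (\<integral>\<^sup>+ \<omega>. indicator ?A \<omega> \<partial>?M)"
    using contrast_comparison_sets[OF P Q] by simp
  also have "\<dots> \<le> (\<integral>\<^sup>+ \<omega>. (\<Prod>i<n. ennreal (?f (\<omega> i))) \<partial>?M)"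
  proof (rule nn_integral_mono)
    fix \<omega>
    have "1 \<le> exp (2 * k * (contrast n \<omega> Q - contrast n \<omega> P))" if "contrast n \<omega> P \<le> contrast n \<omega> Q"
      using that k0 by simp
    then show "indicator ?A \<omega> \<le> (\<Prod>i<n. ennreal (?f (\<omega> i)))"
      unfolding prod_ennreal[OF exp_ge_zero] eq by (auto simp: indicator_def)
  qed
  also have "\<dots> = (\<Prod>i<n. \<integral>\<^sup>+ z. ennreal (?f z) \<partial>obs_law \<nu> G)"
    unfolding sample_law_def
    by (subst product_nn_integral_prod) (use f in auto)
  also have "\<dots> \<le> (\<Prod>i<n. ennreal (exp ((exp (3 * k) - exp (- k)) * sd_vol Q G - (1 - exp (- k)) * sd_vol P G)))"
    unfolding k_def by (intro prod_mono_ennreal obs_law_exp_contrast \<sigma> P Q sub)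
  also have "\<dots> = ennreal (exp (real n * ((exp (3 * k) - exp (- k)) * sd_vol Q G - (1 - exp (- k)) * sd_vol P G)))"
    by (simp add: ennreal_power exp_of_nat_mult[symmetric])
  finally show ?thesis .
qed

end

section \<open>Counting grid polytopes by lists of vertices\<close>

lemma grid_polytope_class_enumeration:
  assumes n: "n > 0"
  shows "(grid_polytope_class n r :: (real ^ 'd) set set)
    \<subseteq> (\<lambda>f. convex hull (f ` {..<r})) ` ({..<r} \<rightarrow>\<^sub>E grid n)"
proof
  fix P :: "(real ^ 'd) set" assume P: "P \<in> grid_polytope_class n r"
  note P' = grid_polytope_classD[OF P]
  define E where "E = {v. v extreme_point_of P}"
  have E: "P = convex hull E" unfolding E_def by (rule Krein_Milman_Minkowski[OF P'(2,1)])
  have fin: "finite E" unfolding E_def by (intro finite_polyhedron_extreme_points polytope_imp_polyhedron P')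
  have card: "card E \<le> r" using P unfolding E_def grid_polytope_class_def polytope_class_def by simp
  have "interior P \<noteq> {}" using P unfolding grid_polytope_class_def polytope_class_def by simp
  then have "E \<noteq> {}" using E by auto
  then have E0: "0 < card E" using fin by (simp add: card_gt_0_iff)
  have "E \<subseteq> grid n"
  proof
    fix v assume v: "v \<in> E"
    then have "v \<in> unit_cube" using P'(3) unfolding E_def extreme_point_of_def by blast
    have "\<exists>k\<le>n. v $ i = real k / real n" for i
    proof -
      obtain k :: int where k: "v $ i = of_int k / real n"
        using P v unfolding E_def grid_polytope_class_def by blast
      have "0 \<le> v $ i" "v $ i \<le> 1" using \<open>v \<in> unit_cube\<close> unfolding unit_cube_def by auto
      then have "0 \<le> k" "k \<le> int n" using n unfolding k by (auto simp: divide_simps)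
      then show ?thesis using k by (intro exI[of _ "nat k"]) auto
    qed
    then show "v \<in> grid n" unfolding grid_def by blast
  qed
  moreover obtain g where g: "bij_betw g {0..<card E} E"
    using ex_bij_betw_nat_finite[OF fin] by blast
  \<comment> \<open>Polytopes with fewer than r vertices are listed by repeating the vertex
    \<open>g 0\<close>, which exists because the interior is nonempty. The restriction makes
    \<open>f\<close> extensional, as \<open>PiE\<close> requires.\<close>
  define f where "f = restrict (\<lambda>i. if i < card E then g i else g 0) {..<r}"
  have gE: "g i \<in> E" if "i < card E" for i using g that by (auto simp: bij_betw_def)
  have "f ` {..<r} \<subseteq> E" using gE E0 unfolding f_def by auto
  moreover have "E \<subseteq> f ` {..<r}"
  proof
    fix v assume "v \<in> E"
    then have "v \<in> g ` {0..<card E}" using g by (simp add: bij_betw_def)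
    then obtain i where "i < card E" "v = g i" by auto
    then show "v \<in> f ` {..<r}" using card unfolding f_def by (intro image_eqI[of _ _ i]) auto
  qed
  ultimately have "f ` {..<r} = E" "f ` {..<r} \<subseteq> grid n" by auto
  moreover then have "f \<in> {..<r} \<rightarrow>\<^sub>E grid n" unfolding f_def by (intro PiE_I) auto
  ultimately have "f \<in> {..<r} \<rightarrow>\<^sub>E grid n" "f ` {..<r} = E" by auto
  then show "P \<in> (\<lambda>f. convex hull (f ` {..<r})) ` ({..<r} \<rightarrow>\<^sub>E grid n)"
    using E by blast
qed

lemma finite_grid_polytope_class: "n > 0 \<Longrightarrow> finite (grid_polytope_class n r :: (real ^ 'd) set set)"
  by (rule finite_subset[OF grid_polytope_class_enumeration])
    (auto intro!: finite_imageI finite_PiE finite_grid)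

lemma card_grid_polytope_class_le:
  assumes n: "n > 0"
  shows "card (grid_polytope_class n r :: (real ^ 'd) set set) \<le> (n + 1) ^ (CARD('d) * r)"
proof -
  have fin: "finite ({..<r} \<rightarrow>\<^sub>E (grid n :: (real ^ 'd) set))"
    by (intro finite_PiE finite_grid) auto
  have "card (grid_polytope_class n r :: (real ^ 'd) set set) \<le> card ({..<r} \<rightarrow>\<^sub>E (grid n :: (real ^ 'd) set))"
    by (rule surj_card_le[OF fin grid_polytope_class_enumeration[OF n]])
  also have "\<dots> = card (grid n :: (real ^ 'd) set) ^ r" by (simp add: card_PiE)
  also have "\<dots> \<le> ((n + 1) ^ CARD('d)) ^ r" by (intro power_mono card_grid_le) simp
  finally show ?thesis by (simp add: power_mult)
qed

text \<open>The loss is at most c off the bad event B and at most 1 on it; q will be the inverse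
  rate. Domination by a step function asks for measurability of B alone, so the argument never has
  to deal with measurability of the adaptive estimator.\<close>

lemma nn_integral_le_off_event:
  fixes g :: "'a \<Rightarrow> real"
  assumes "prob_space M" and B: "B \<in> sets M" "emeasure M B \<le> ennreal p" and p: "0 \<le> p"
    and c: "0 \<le> c" and q: "0 \<le> q"
    and g: "\<And>\<omega>. \<omega> \<in> space M \<Longrightarrow> g \<omega> \<le> 1" "\<And>\<omega>. \<omega> \<in> space M \<Longrightarrow> \<omega> \<notin> B \<Longrightarrow> g \<omega> \<le> c"
  shows "(\<integral>\<^sup>+ \<omega>. ennreal (q * g \<omega>) \<partial>M) \<le> ennreal (q * (c + p))"
proof -
  interpret prob_space M by fact
  have "(\<integral>\<^sup>+ \<omega>. ennreal (q * g \<omega>) \<partial>M) \<le> (\<integral>\<^sup>+ \<omega>. ennreal (q * c) + ennreal q * indicator B \<omega> \<partial>M)"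
  proof (rule nn_integral_mono)
    fix \<omega> assume \<omega>: "\<omega> \<in> space M"
    have "q * g \<omega> \<le> q * c + q * indicator B \<omega>"
      using g[OF \<omega>] c q by (auto simp: indicator_def distrib_left[symmetric] intro!: mult_left_mono)
    then have "ennreal (q * g \<omega>) \<le> ennreal (q * c + q * indicator B \<omega>)" by (rule ennreal_leI)
    then show "ennreal (q * g \<omega>) \<le> ennreal (q * c) + ennreal q * indicator B \<omega>"
      using c q by (simp add: ennreal_plus ennreal_mult ennreal_indicator)
  qed
  also have "\<dots> = ennreal (q * c) + ennreal q * emeasure M B"
    using B(1) by (subst nn_integral_add) (auto simp: nn_integral_cmult_indicator emeasure_space_1)
  also have "\<dots> \<le> ennreal (q * c) + ennreal q * ennreal p"
    using B(2) by (intro add_left_mono mult_left_mono) auto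
  also have "\<dots> = ennreal (q * (c + p))"
    using c q p by (simp add: ennreal_plus ennreal_mult distrib_left)
  finally show ?thesis .
qed

section \<open>Tail bound for one contrast minimizer\<close>

context
  fixes \<sigma> :: real and \<nu> :: "real measure" and G :: "(real ^ 'd) set"
  assumes \<nu>: "subgaussian_law \<sigma> \<nu>" and G: "compact G"
begin

lemma estimator_in_class:
  assumes "is_estimator n r T" "\<omega> \<in> space (sample_law n \<nu> G)"
  shows "T \<omega> \<in> grid_polytope_class n r"
  using assms measurable_space[of T _ "count_space (grid_polytope_class n r)"]
  unfolding is_estimator_def space_sample_law[OF \<nu> G] by fastforce

text \<open>The estimator is measurable into a discrete sigma-algebra, so \<open>\<Phi>\<close> can
  be arbitrary.\<close>

lemma estimator_event_sets:
  assumes "is_estimator n r T"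
  shows "{\<omega> \<in> space (sample_law n \<nu> G). \<Phi> (T \<omega>)} \<in> sets (sample_law n \<nu> G)"
proof -
  let ?N = "PiM {..<n} (\<lambda>_. borel \<Otimes>\<^sub>M borel) :: 'd sample measure"
  have T: "T \<in> ?N \<rightarrow>\<^sub>M count_space (grid_polytope_class n r)"
    using assms unfolding is_estimator_def by blast
  have "T -` {P \<in> grid_polytope_class n r. \<Phi> P} \<inter> space ?N \<in> sets ?N"
    using T by (rule measurable_sets) auto
  moreover have "T -` {P \<in> grid_polytope_class n r. \<Phi> P} \<inter> space ?N = {\<omega> \<in> space ?N. \<Phi> (T \<omega>)}"
    using measurable_space[OF T] by auto
  ultimately show ?thesis unfolding sets_sample_law[OF \<nu> G] space_sample_law[OF \<nu> G] by simp
qed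

text \<open>A minimizer with loss at least t is a polytope P that does at least as well as Q in
  contrast. The threshold t makes the Chernoff exponent for such P at most -(2 d r + 1) ln n. The
  part 2 d r pays for the union over the class, and the remaining 1 gives the probability
  1/n.\<close>

lemma estimator_tail:
  assumes \<sigma>: "0 < \<sigma>" and n: "2 \<le> n" and Gc: "G \<subseteq> unit_cube"
    and T: "is_estimator n r T" and Q: "Q \<in> grid_polytope_class n r"
  defines "k \<equiv> 1 / (8 * \<sigma>\<^sup>2)"
  defines "t \<equiv> ((exp (3 * k) - exp (- k)) * sd_vol Q G
      + (2 * real CARD('d) * real r + 1) * (ln (real n) / real n)) / (1 - exp (- k))"
  shows "emeasure (sample_law n \<nu> G) {\<omega> \<in> space (sample_law n \<nu> G). t \<le> sd_vol (T \<omega>) G} \<le> ennreal (1 / real n)"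
proof -
  let ?M = "sample_law n \<nu> G"
  let ?a = "exp (3 * k) - exp (- k)" and ?b = "1 - exp (- k)"
  let ?C = "{P \<in> grid_polytope_class n r. t \<le> sd_vol P G}"
  let ?A = "\<lambda>P. {\<omega> \<in> space ?M. contrast n \<omega> P \<le> contrast n \<omega> Q}"
  let ?e = "exp (- (2 * real CARD('d) * real r + 1) * ln (real n))"
  note Q' = grid_polytope_classD[OF Q]
  have b: "?b > 0" using \<sigma> unfolding k_def by simp
  have fin: "finite ?C" using n by (intro finite_Collect_conjI disjI1) (simp add: finite_grid_polytope_class)
  have meas: "?A P \<in> sets ?M" if "P \<in> ?C" for P
    using that by (intro contrast_comparison_sets[OF \<nu> G] Q') (auto dest: grid_polytope_classD)
  have "{\<omega> \<in> space ?M. t \<le> sd_vol (T \<omega>) G} \<subseteq> (\<Union>P\<in>?C. ?A P)"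
  proof
    fix \<omega> assume \<omega>: "\<omega> \<in> {\<omega> \<in> space ?M. t \<le> sd_vol (T \<omega>) G}"
    then have "\<not> contrast n \<omega> Q < contrast n \<omega> (T \<omega>)"
      using T Q unfolding is_estimator_def is_arg_min_def space_sample_law[OF \<nu> G] by blast
    then show "\<omega> \<in> (\<Union>P\<in>?C. ?A P)"
      using \<omega> estimator_in_class[OF T] by (intro UN_I[of "T \<omega>"]) auto
  qed
  then have "emeasure ?M {\<omega> \<in> space ?M. t \<le> sd_vol (T \<omega>) G} \<le> emeasure ?M (\<Union>P\<in>?C. ?A P)"
    using meas fin by (intro emeasure_mono sets.finite_UN) auto
  also have "\<dots> \<le> (\<Sum>P\<in>?C. emeasure ?M (?A P))"
    using meas fin by (intro emeasure_subadditive_finite) auto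
  also have "\<dots> \<le> (\<Sum>P\<in>?C. ennreal ?e)"
  proof (rule sum_mono)
    fix P assume P: "P \<in> ?C"
    then have P': "P \<in> grid_polytope_class n r" "t \<le> sd_vol P G" by auto
    have "emeasure ?M (?A P) \<le> ennreal (exp (real n * (?a * sd_vol Q G - ?b * sd_vol P G)))"
      unfolding k_def
      by (rule contrast_comparison_tail[OF \<nu> G \<sigma> grid_polytope_classD(2)[OF P'(1)] Q'(2)
            grid_polytope_classD(3)[OF P'(1)] Q'(3) Gc])
    also have "\<dots> \<le> ennreal ?e"
    proof (intro ennreal_leI, subst exp_le_cancel_iff)
      have "?b * t \<le> ?b * sd_vol P G" using b P'(2) by simp
      then have "real n * (?a * sd_vol Q G - ?b * sd_vol P G) \<le> real n * (?a * sd_vol Q G - ?b * t)"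
        by (intro mult_left_mono) auto
      also have "?b * t = ?a * sd_vol Q G + (2 * real CARD('d) * real r + 1) * (ln (real n) / real n)"
        unfolding t_def using b by simp
      also have "real n * (?a * sd_vol Q G - \<dots>) = - (2 * real CARD('d) * real r + 1) * ln (real n)"
        using n by (simp add: field_simps)
      finally show "real n * (?a * sd_vol Q G - ?b * sd_vol P G) \<le> - (2 * real CARD('d) * real r + 1) * ln (real n)" .
    qed
    finally show "emeasure ?M (?A P) \<le> ennreal ?e" .
  qed
  also have "\<dots> = ennreal (real (card ?C) * ?e)"
    by (simp add: ennreal_mult ennreal_of_nat_eq_real_of_nat)
  also have "\<dots> \<le> ennreal (exp (2 * real CARD('d) * real r * ln (real n)) * ?e)"
  proof (intro ennreal_leI mult_right_mono)
    have "card ?C \<le> card (grid_polytope_class n r :: (real ^ 'd) set set)"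
      using n by (intro card_mono finite_grid_polytope_class) auto
    also have "\<dots> \<le> (n + 1) ^ (CARD('d) * r)" using n by (intro card_grid_polytope_class_le) simp
    \<comment> \<open>\<open>n \<ge> 2\<close> gives n + 1 <= n^2, which turns the size of the class
      into the power n^(2 d r) that the exponent was made to absorb.\<close>
    also have "\<dots> \<le> (n ^ 2) ^ (CARD('d) * r)"
    proof (intro power_mono)
      have "2 * n \<le> n * n" using n by (rule mult_right_mono) simp
      then show "n + 1 \<le> n ^ 2" using n unfolding power2_eq_square by linarith
    qed simp
    finally have "card ?C \<le> n ^ (2 * (CARD('d) * r))" by (simp only: power_mult)
    then have "real (card ?C) \<le> real n ^ (2 * (CARD('d) * r))"
      by (simp only: of_nat_power[symmetric] of_nat_le_iff)
    also have "\<dots> = exp (real (2 * (CARD('d) * r)) * ln (real n))"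
      using n by (simp only: exp_of_nat_mult) simp
    finally show "real (card ?C) \<le> exp (2 * real CARD('d) * real r * ln (real n))" by (simp add: mult.assoc)
  qed simp
  also have "exp (2 * real CARD('d) * real r * ln (real n)) * ?e = exp (- ln (real n))"
    by (simp add: exp_add[symmetric] algebra_simps)
  also have "\<dots> = 1 / real n" using n by (simp add: exp_minus divide_inverse)
  finally show ?thesis .
qed

end

section \<open>The adaptive estimator\<close>

text \<open>The three ways in which the minimum is used: its range, the defining comparisons at the
  selected index, and a violated comparison at every smaller index.\<close>

lemma r_hat_props:
  fixes T :: "nat \<Rightarrow> 'd::finite sample \<Rightarrow> (real ^ 'd) set"
  assumes R: "CARD('d) + 1 \<le> R_max CARD('d) n" and n: "1 \<le> n" and C2: "0 < C\<^sub>2"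
  shows "r_hat C\<^sub>2 n T \<omega> \<in> {CARD('d) + 1..R_max CARD('d) n}"
    and "\<And>r. r_hat C\<^sub>2 n T \<omega> \<le> r \<Longrightarrow> r \<le> R_max CARD('d) n \<Longrightarrow>
      sd_vol (adaptive C\<^sub>2 n T \<omega>) (T r \<omega>) \<le> 6 * real CARD('d) * real r * ln (real n) / (C\<^sub>2 * real n)"
    and "\<And>r. CARD('d) + 1 \<le> r \<Longrightarrow> r < r_hat C\<^sub>2 n T \<omega> \<Longrightarrow>
      \<exists>s\<in>{r..R_max CARD('d) n}. 6 * real CARD('d) * real s * ln (real n) / (C\<^sub>2 * real n) < sd_vol (T r \<omega>) (T s \<omega>)"
proof -
  let ?R = "R_max CARD('d) n"
  define A where "A = {r \<in> {CARD('d) + 1..?R}. \<forall>r' \<in> {r..?R}.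
      sd_vol (T r \<omega>) (T r' \<omega>) \<le> 6 * real CARD('d) * real r' * ln (real n) / (C\<^sub>2 * real n)}"
  have rh: "r_hat C\<^sub>2 n T \<omega> = Min A" unfolding r_hat_def A_def ..
  have fin: "finite A" unfolding A_def by simp
  \<comment> \<open>At the last index the only comparison is of an estimator with itself.\<close>
  have "?R \<in> A" using R n C2 unfolding A_def by auto
  then have mem: "r_hat C\<^sub>2 n T \<omega> \<in> A" unfolding rh using fin by (intro Min_in) auto
  then show rR: "r_hat C\<^sub>2 n T \<omega> \<in> {CARD('d) + 1..?R}" unfolding A_def by blast
  show "sd_vol (adaptive C\<^sub>2 n T \<omega>) (T r \<omega>) \<le> 6 * real CARD('d) * real r * ln (real n) / (C\<^sub>2 * real n)"
    if "r_hat C\<^sub>2 n T \<omega> \<le> r" "r \<le> ?R" for r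
    using mem that unfolding A_def adaptive_def by auto
  show "\<exists>s\<in>{r..?R}. 6 * real CARD('d) * real s * ln (real n) / (C\<^sub>2 * real n) < sd_vol (T r \<omega>) (T s \<omega>)"
    if "CARD('d) + 1 \<le> r" "r < r_hat C\<^sub>2 n T \<omega>" for r
  proof -
    have "r \<notin> A" using that(2) fin unfolding rh by (meson Min_le not_le)
    then show ?thesis using that rR unfolding A_def by force
  qed
qed

section \<open>Risk of the selected estimator for large and for small r\<close>

context
  fixes \<sigma> C\<^sub>2 :: real and \<nu> :: "real measure" and G :: "(real ^ 'd) set" and n :: nat
    and T :: "nat \<Rightarrow> 'd sample \<Rightarrow> (real ^ 'd) set"
  assumes \<nu>: "subgaussian_law \<sigma> \<nu>" and G: "G \<in> convex_class" and n: "2 \<le> n"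
    and R: "CARD('d) + 1 \<le> R_max CARD('d) n" and C2: "0 < C\<^sub>2"
    and T: "\<forall>r \<in> {CARD('d) + 1..R_max CARD('d) n}. is_estimator n r (T r)"
begin

lemma compact_target: "compact G" "G \<subseteq> unit_cube"
  using G unfolding convex_class_def by auto

lemma estimator_props:
  assumes "\<omega> \<in> space (sample_law n \<nu> G)" "r \<in> {CARD('d) + 1..R_max CARD('d) n}"
  shows "compact (T r \<omega>)" "T r \<omega> \<subseteq> unit_cube"
proof -
  have "T r \<omega> \<in> grid_polytope_class n r"
    using estimator_in_class[OF \<nu> compact_target(1)] T assms by blast
  then show "compact (T r \<omega>)" "T r \<omega> \<subseteq> unit_cube" by (auto dest: grid_polytope_classD)
qed

lemma adaptive_props:
  assumes "\<omega> \<in> space (sample_law n \<nu> G)"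
  shows "compact (adaptive C\<^sub>2 n T \<omega>)" "sd_vol (adaptive C\<^sub>2 n T \<omega>) G \<le> 1"
proof -
  have "r_hat C\<^sub>2 n T \<omega> \<in> {CARD('d) + 1..R_max CARD('d) n}" using n by (intro r_hat_props(1) R C2) simp
  note * = estimator_props[OF assms this]
  show "compact (adaptive C\<^sub>2 n T \<omega>)" unfolding adaptive_def by (rule *)
  show "sd_vol (adaptive C\<^sub>2 n T \<omega>) G \<le> 1"
    unfolding adaptive_def by (rule sd_vol_le_1[OF *(1) compact_target(1) *(2) compact_target(2)])
qed

text \<open>Triangle inequality through the estimator of index R_n. The constants are: 6 d /
  \<open>C\<^sub>2\<close> from the selection rule, the quotient from the threshold of
  \<open>estimator_tail\<close>, and 2 from the failure probability 1/n, which is at most twice the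
  rate.\<close>

lemma adaptive_risk_convex:
  assumes \<sigma>: "0 < \<sigma>" and d: "2 \<le> CARD('d)"
    and Q: "Q \<in> grid_polytope_class n (R_max CARD('d) n)" "sd_vol Q G \<le> C * rate CARD('d) n \<infinity>"
    and q: "0 \<le> q"
  defines "k \<equiv> 1 / (8 * \<sigma>\<^sup>2)"
  shows "(\<integral>\<^sup>+ \<omega>. ennreal (q * sd_vol (adaptive C\<^sub>2 n T \<omega>) G) \<partial>sample_law n \<nu> G)
    \<le> ennreal (q * ((6 * real CARD('d) / C\<^sub>2
        + ((exp (3 * k) - exp (- k)) * C + 2 * real CARD('d) + 1) / (1 - exp (- k)) + 2) * rate CARD('d) n \<infinity>))"
proof -
  let ?M = "sample_law n \<nu> G" and ?R = "R_max CARD('d) n" and ?\<rho> = "rate CARD('d) n \<infinity>"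
  let ?D = "real CARD('d)"
  let ?a = "exp (3 * k) - exp (- k)" and ?b = "1 - exp (- k)"
  define \<tau> where "\<tau> = ln (real n) / real n"
  define t where "t = (?a * sd_vol Q G + (2 * ?D * real ?R + 1) * \<tau>) / ?b"
  let ?B = "{\<omega> \<in> space ?M. t \<le> sd_vol (T ?R \<omega>) G}"
  have k: "k > 0" using \<sigma> unfolding k_def by simp
  then have b: "?b > 0" and a: "?a \<ge> 0" by auto
  have \<tau>: "0 < \<tau>" "\<tau> \<le> ?\<rho>" "1 / real n \<le> 2 * \<tau>" "real ?R * \<tau> \<le> ?\<rho>"
    using log_ratio_bounds[OF n] log_ratio_le_rate_infinity[OF n d] R_max_log_ratio_le[OF n]
    unfolding \<tau>_def by auto
  have TR: "is_estimator n ?R (T ?R)" using T R by auto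
  have t0: "0 \<le> t" unfolding t_def using a b \<tau>(1) sd_vol_nonneg[of Q G]
    by (intro divide_nonneg_pos add_nonneg_nonneg mult_nonneg_nonneg) auto
  have c0: "0 \<le> 6 * ?D / C\<^sub>2 * (real ?R * \<tau>)" using C2 \<tau>(1) by simp
  have "(\<integral>\<^sup>+ \<omega>. ennreal (q * sd_vol (adaptive C\<^sub>2 n T \<omega>) G) \<partial>?M)
    \<le> ennreal (q * ((6 * ?D / C\<^sub>2 * (real ?R * \<tau>) + t) + 1 / real n))"
  proof (rule nn_integral_le_off_event)
    show "prob_space ?M" by (rule prob_space_sample_law[OF \<nu> compact_target(1)])
    show "?B \<in> sets ?M" by (rule estimator_event_sets[OF \<nu> compact_target(1) TR])
    show "emeasure ?M ?B \<le> ennreal (1 / real n)"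
      unfolding t_def \<tau>_def k_def
      by (rule estimator_tail[OF \<nu> compact_target(1) \<sigma> n compact_target(2) TR Q(1)])
    show "sd_vol (adaptive C\<^sub>2 n T \<omega>) G \<le> 1" if "\<omega> \<in> space ?M" for \<omega>
      by (rule adaptive_props(2)[OF that])
    show "sd_vol (adaptive C\<^sub>2 n T \<omega>) G \<le> 6 * ?D / C\<^sub>2 * (real ?R * \<tau>) + t" if \<omega>: "\<omega> \<in> space ?M" "\<omega> \<notin> ?B" for \<omega>
    proof -
      have "r_hat C\<^sub>2 n T \<omega> \<le> ?R" using r_hat_props(1)[OF R _ C2, of T \<omega>] n by simp
      then have "sd_vol (adaptive C\<^sub>2 n T \<omega>) (T ?R \<omega>) \<le> 6 * ?D * real ?R * ln (real n) / (C\<^sub>2 * real n)"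
        using n by (intro r_hat_props(2)[OF R _ C2]) auto
      moreover have "sd_vol (T ?R \<omega>) G \<le> t" using \<omega> by auto
      moreover have "sd_vol (adaptive C\<^sub>2 n T \<omega>) G
          \<le> sd_vol (adaptive C\<^sub>2 n T \<omega>) (T ?R \<omega>) + sd_vol (T ?R \<omega>) G"
        using R by (intro sd_vol_triangle adaptive_props estimator_props compact_target \<omega>(1)) auto
      ultimately show ?thesis unfolding \<tau>_def by simp
    qed
  qed (use t0 c0 q in auto)
  also have "\<dots> \<le> ennreal (q * ((6 * ?D / C\<^sub>2 + (?a * C + 2 * ?D + 1) / ?b + 2) * ?\<rho>))"
  proof (intro ennreal_leI mult_left_mono q)
    have "6 * ?D / C\<^sub>2 * (real ?R * \<tau>) \<le> 6 * ?D / C\<^sub>2 * ?\<rho>" using \<tau>(4) C2 by (intro mult_left_mono) auto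
    moreover have "t \<le> (?a * C + 2 * ?D + 1) / ?b * ?\<rho>"
    proof -
      have "?a * sd_vol Q G \<le> ?a * (C * ?\<rho>)" using Q(2) a by (rule mult_left_mono)
      moreover have "2 * ?D * (real ?R * \<tau>) \<le> 2 * ?D * ?\<rho>" using \<tau>(4) by (intro mult_left_mono) auto
      moreover have "(2 * ?D * real ?R + 1) * \<tau> = 2 * ?D * (real ?R * \<tau>) + \<tau>"
        "(?a * C + 2 * ?D + 1) * ?\<rho> = ?a * (C * ?\<rho>) + 2 * ?D * ?\<rho> + ?\<rho>"
        by (simp_all only: distrib_right mult.assoc mult_1_left)
      ultimately have "?a * sd_vol Q G + (2 * ?D * real ?R + 1) * \<tau> \<le> (?a * C + 2 * ?D + 1) * ?\<rho>"
        using \<tau>(2) by linarith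
      then show ?thesis unfolding t_def using b by (simp add: divide_right_mono)
    qed
    ultimately show "6 * ?D / C\<^sub>2 * (real ?R * \<tau>) + t + 1 / real n
      \<le> (6 * ?D / C\<^sub>2 + (?a * C + 2 * ?D + 1) / ?b + 2) * ?\<rho>"
      using \<tau>(2,3) by (simp only: distrib_right)
  qed
  finally show ?thesis .
qed

text \<open>The factor 9 is 6 from the selection rule plus 3 from the loss of the estimator of index
  r itself. The failure probability counts two events for each index from r to R_n.\<close>

lemma adaptive_risk_polytope:
  assumes r: "r \<in> {CARD('d) + 1..R_max CARD('d) n}" and p: "0 \<le> p" and q: "0 \<le> q"
    and dev: "\<And>s s'. s \<in> {CARD('d) + 1..R_max CARD('d) n} \<Longrightarrow> s' \<in> {r..R_max CARD('d) n} \<Longrightarrow> s \<le> s' \<Longrightarrow> r \<le> s \<Longrightarrow>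
      emeasure (sample_law n \<nu> G) {\<omega> \<in> space (sample_law n \<nu> G).
        3 * real CARD('d) * real s' * ln (real n) / (C\<^sub>2 * real n) \<le> sd_vol (T s \<omega>) G} \<le> ennreal p"
  shows "(\<integral>\<^sup>+ \<omega>. ennreal (q * sd_vol (adaptive C\<^sub>2 n T \<omega>) G) \<partial>sample_law n \<nu> G)
    \<le> ennreal (q * (9 * real CARD('d) * real r * ln (real n) / (C\<^sub>2 * real n) + 2 * real (R_max CARD('d) n) * p))"
proof (rule nn_integral_le_off_event)
  let ?M = "sample_law n \<nu> G" and ?R = "R_max CARD('d) n"
  let ?u = "\<lambda>s. 3 * real CARD('d) * real s * ln (real n) / (C\<^sub>2 * real n)"
  \<comment> \<open>The comparison of indices r and s is made at the scale of s, so
    \<open>T r\<close> is needed within the larger threshold of s as well; hence both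
    \<open>E r s\<close> and \<open>E s s\<close>.\<close>
  define E where "E = (\<lambda>s s'. {\<omega> \<in> space ?M. ?u s' \<le> sd_vol (T s \<omega>) G})"
  let ?B = "\<Union>s\<in>{r..?R}. E r s \<union> E s s"
  have E_sets: "E s s' \<in> sets ?M" if "s \<in> {CARD('d) + 1..?R}" for s s'
    unfolding E_def using T that by (intro estimator_event_sets[OF \<nu> compact_target(1)]) auto
  show "prob_space ?M" by (rule prob_space_sample_law[OF \<nu> compact_target(1)])
  have EE: "E r s \<union> E s s \<in> sets ?M" if "s \<in> {r..?R}" for s
  proof (rule sets.Un[OF E_sets[OF r] E_sets])
    show "s \<in> {CARD('d) + 1..?R}" using r that by simp
  qed
  then show "?B \<in> sets ?M" by (intro sets.finite_UN) auto
  have "emeasure ?M ?B \<le> (\<Sum>s\<in>{r..?R}. emeasure ?M (E r s \<union> E s s))"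
    using EE by (intro emeasure_subadditive_finite) auto
  also have "\<dots> \<le> (\<Sum>s\<in>{r..?R}. ennreal (2 * p))"
  proof (rule sum_mono)
    fix s assume s: "s \<in> {r..?R}"
    have "emeasure ?M (E r s \<union> E s s) \<le> emeasure ?M (E r s) + emeasure ?M (E s s)"
      using E_sets[of r s] E_sets[of s s] r s by (intro emeasure_subadditive) simp_all
    also have "\<dots> \<le> ennreal p + ennreal p" unfolding E_def using r s by (intro add_mono dev) auto
    also have "\<dots> = ennreal (2 * p)" using p by (simp add: ennreal_plus[symmetric] del: ennreal_plus)
    finally show "emeasure ?M (E r s \<union> E s s) \<le> ennreal (2 * p)" .
  qed
  also have "\<dots> = ennreal (real (card {r..?R}) * (2 * p))"
    using p by (simp add: ennreal_mult ennreal_of_nat_eq_real_of_nat)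
  also have "\<dots> \<le> ennreal (2 * real ?R * p)"
  proof (intro ennreal_leI)
    have "real (card {r..?R}) \<le> real ?R" using r by auto
    then have "real (card {r..?R}) * (2 * p) \<le> real ?R * (2 * p)" using p by (intro mult_right_mono) auto
    then show "real (card {r..?R}) * (2 * p) \<le> 2 * real ?R * p" by simp
  qed
  finally show "emeasure ?M ?B \<le> ennreal (2 * real ?R * p)" .
  show "sd_vol (adaptive C\<^sub>2 n T \<omega>) G \<le> 1" if "\<omega> \<in> space ?M" for \<omega>
    by (rule adaptive_props(2)[OF that])
  show "sd_vol (adaptive C\<^sub>2 n T \<omega>) G \<le> 9 * real CARD('d) * real r * ln (real n) / (C\<^sub>2 * real n)"
    if \<omega>: "\<omega> \<in> space ?M" "\<omega> \<notin> ?B" for \<omega>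
  proof -
    have good: "sd_vol (T r \<omega>) G < ?u s" "sd_vol (T s \<omega>) G < ?u s" if "s \<in> {r..?R}" for s
      using \<omega> that unfolding E_def by force+
    have u: "6 * real CARD('d) * real s * ln (real n) / (C\<^sub>2 * real n) = ?u s + ?u s" for s by simp
    have "r_hat C\<^sub>2 n T \<omega> \<le> r"
    proof (rule ccontr)
      assume "\<not> r_hat C\<^sub>2 n T \<omega> \<le> r"
      then obtain s where s: "s \<in> {r..?R}" "?u s + ?u s < sd_vol (T r \<omega>) (T s \<omega>)"
        using r_hat_props(3)[OF R _ C2, of r T \<omega>] r n unfolding u by auto
      have "sd_vol (T r \<omega>) (T s \<omega>) \<le> sd_vol (T r \<omega>) G + sd_vol G (T s \<omega>)"
        using r s(1) by (intro sd_vol_triangle estimator_props compact_target \<omega>(1)) auto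
      then show False using good[OF s(1)] s(2) sd_vol_commute[of G "T s \<omega>"] by linarith
    qed
    then have near: "sd_vol (adaptive C\<^sub>2 n T \<omega>) (T r \<omega>) \<le> ?u r + ?u r"
      using r_hat_props(2)[OF R _ C2, of T \<omega> r] r n unfolding u by simp
    have "sd_vol (adaptive C\<^sub>2 n T \<omega>) G \<le> sd_vol (adaptive C\<^sub>2 n T \<omega>) (T r \<omega>) + sd_vol (T r \<omega>) G"
      using r by (intro sd_vol_triangle adaptive_props estimator_props compact_target \<omega>(1)) auto
    also have "\<dots> \<le> (?u r + ?u r) + ?u r"
      using good(1)[of r] r by (intro add_mono near) auto
    also have "\<dots> = 9 * real CARD('d) * real r * ln (real n) / (C\<^sub>2 * real n)"
      by (simp add: add_divide_distrib[symmetric])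
    finally show ?thesis .
  qed
  show "0 \<le> 9 * real CARD('d) * real r * ln (real n) / (C\<^sub>2 * real n)" using C2 n by simp
qed (use p q in auto)

end

text \<open>The centering uses up 2 d s ln n / \<open>C\<^sub>2\<close>, which is at most 2 x for
  \<open>s \<le> s'\<close>. Out of 3 x there remains x, and exp(- \<open>C\<^sub>2\<close> x) =
  n^(-d s') is at most n^(-2) because d >= 2 and s' >= 1.\<close>

lemma deviation_at_log_scale:
  fixes T :: "'d sample \<Rightarrow> (real ^ 'd) set"
  assumes \<nu>: "subgaussian_law \<sigma> \<nu>" and T: "is_estimator n s T" and P: "P \<in> polytope_class s"
    and n: "2 \<le> n" and d: "2 \<le> CARD('d)" and s: "1 \<le> s" "s \<le> s'" and C: "0 < C\<^sub>1" "0 < C\<^sub>2"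
    and deviation: "\<And>x. 0 < x \<Longrightarrow> (SUP P \<in> polytope_class s. emeasure (sample_law n \<nu> P)
           {\<omega> \<in> space (sample_law n \<nu> P).
              x \<le> real n * (sd_vol (T \<omega>) P - 2 * real CARD('d) * real s * ln (real n) / (C\<^sub>2 * real n))})
        \<le> ennreal (C\<^sub>1 * exp (- C\<^sub>2 * x))"
  shows "emeasure (sample_law n \<nu> P) {\<omega> \<in> space (sample_law n \<nu> P).
      3 * real CARD('d) * real s' * ln (real n) / (C\<^sub>2 * real n) \<le> sd_vol (T \<omega>) P} \<le> ennreal (C\<^sub>1 / (real n)\<^sup>2)"
proof -
  let ?M = "sample_law n \<nu> P" and ?D = "real CARD('d)"
  define x where "x = ?D * real s' * ln (real n) / C\<^sub>2"
  let ?\<Phi> = "\<lambda>A. x \<le> real n * (sd_vol A P - 2 * ?D * real s * ln (real n) / (C\<^sub>2 * real n))"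
  have ln: "0 < ln (real n)" using n by simp
  have "0 < x" unfolding x_def using ln s C d by (intro divide_pos_pos mult_pos_pos) auto
  have "?\<Phi> (T \<omega>)" if "3 * ?D * real s' * ln (real n) / (C\<^sub>2 * real n) \<le> sd_vol (T \<omega>) P" for \<omega>
  proof -
    have "real n * (3 * ?D * real s' * ln (real n) / (C\<^sub>2 * real n)) = 3 * x"
      unfolding x_def using n by simp
    then have "3 * x \<le> real n * sd_vol (T \<omega>) P"
      using mult_left_mono[OF that, of "real n"] by simp
    moreover have "real n * (2 * ?D * real s * ln (real n) / (C\<^sub>2 * real n)) = 2 * (?D * real s * ln (real n) / C\<^sub>2)"
      using n by simp
    moreover have "?D * real s * ln (real n) / C\<^sub>2 \<le> x"
      unfolding x_def using s ln C by (intro divide_right_mono mult_right_mono mult_left_mono) auto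
    ultimately show ?thesis by (simp only: right_diff_distrib)
  qed
  then have "emeasure ?M {\<omega> \<in> space ?M. 3 * ?D * real s' * ln (real n) / (C\<^sub>2 * real n) \<le> sd_vol (T \<omega>) P}
    \<le> emeasure ?M {\<omega> \<in> space ?M. ?\<Phi> (T \<omega>)}"
    by (intro emeasure_mono estimator_event_sets[OF \<nu> polytope_classD(2)[OF P] T]) blast
  also have "\<dots> \<le> ennreal (C\<^sub>1 * exp (- C\<^sub>2 * x))"
    by (rule order_trans[OF SUP_upper[OF P] deviation[OF \<open>0 < x\<close>]])
  also have "\<dots> \<le> ennreal (C\<^sub>1 / (real n)\<^sup>2)"
  proof (rule ennreal_leI)
    have "2 * 1 \<le> ?D * real s'" using d s by (intro mult_mono) auto
    then have "2 * ln (real n) \<le> ?D * real s' * ln (real n)" using ln by simp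
    also have "\<dots> = C\<^sub>2 * x" unfolding x_def using C by simp
    finally have "exp (- C\<^sub>2 * x) \<le> exp (- (2 * ln (real n)))" by simp
    also have "\<dots> = 1 / (real n)\<^sup>2"
      using n by (simp add: exp_minus exp_double divide_inverse)
    finally show "C\<^sub>1 * exp (- C\<^sub>2 * x) \<le> C\<^sub>1 / (real n)\<^sup>2"
      using C(1) mult_left_mono[of _ _ C\<^sub>1] by fastforce
  qed
  finally show ?thesis .
qed

theorem theorem5:
  fixes \<sigma> C\<^sub>1 C\<^sub>2 :: real
  assumes d: "2 \<le> CARD('d::finite)"
    and pos: "0 < \<sigma>" "0 < C\<^sub>1" "0 < C\<^sub>2"
    and deviation: "\<And>(\<nu> :: real measure) (n :: nat) (r :: nat) (T :: 'd sample \<Rightarrow> (real ^ 'd) set) (x :: real).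
      subgaussian_law \<sigma> \<nu> \<Longrightarrow> 1 \<le> n \<Longrightarrow> CARD('d) + 1 \<le> r \<Longrightarrow> is_estimator n r T \<Longrightarrow> 0 < x \<Longrightarrow>
      (SUP P \<in> polytope_class r.
         emeasure (sample_law n \<nu> P)
           {\<omega> \<in> space (sample_law n \<nu> P).
              x \<le> real n * (sd_vol (T \<omega>) P - 2 * real CARD('d) * real r * ln (real n) / (C\<^sub>2 * real n))})
        \<le> ennreal (C\<^sub>1 * exp (- C\<^sub>2 * x))"
  shows "\<exists>C\<^sub>5 > (0::real). \<forall>(\<nu> :: real measure) (n :: nat) (T :: nat \<Rightarrow> 'd sample \<Rightarrow> (real ^ 'd) set).
      subgaussian_law \<sigma> \<nu> \<longrightarrow> 2 \<le> n \<longrightarrow> CARD('d) + 1 \<le> R_max CARD('d) n \<longrightarrow>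
      (\<forall>r \<in> {CARD('d) + 1..R_max CARD('d) n}. is_estimator n r (T r)) \<longrightarrow>
      (SUP r \<in> {enat (CARD('d) + 1)..}. SUP P \<in> shape_class r.
         \<integral>\<^sup>+ \<omega>. ennreal (inverse (rate CARD('d) n r) * sd_vol (adaptive C\<^sub>2 n T \<omega>) P)
           \<partial>sample_law n \<nu> P)
        \<le> ennreal C\<^sub>5"
proof -
  let ?D = "real CARD('d)"
  obtain C where C: "0 < C" "\<And>n G. 2 \<le> n \<Longrightarrow> CARD('d) + 1 \<le> R_max CARD('d) n \<Longrightarrow> G \<in> convex_class \<Longrightarrow>
     \<exists>Q \<in> grid_polytope_class n (R_max CARD('d) n). sd_vol Q (G :: (real ^ 'd) set) \<le> C * rate CARD('d) n \<infinity>"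
    using grid_polytope_approximation_rate[OF d] by blast
  define k where "k = 1 / (8 * \<sigma>\<^sup>2)"
  define K\<^sub>1 where "K\<^sub>1 = 6 * ?D / C\<^sub>2 + ((exp (3 * k) - exp (- k)) * C + 2 * ?D + 1) / (1 - exp (- k)) + 2"
  \<comment> \<open>The 8 arises from 2 R_n events with R_n <= 2 n, each of probability at most
    \<open>C\<^sub>1\<close> / n^2, and from 1/n <= 2 ln n / n.\<close>
  define K\<^sub>2 where "K\<^sub>2 = 9 * ?D / C\<^sub>2 + 8 * C\<^sub>1"
  have "0 < k" using pos unfolding k_def by simp
  then have "0 \<le> exp (3 * k) - exp (- k)" "0 < 1 - exp (- k)" by auto
  then have K1: "0 < K\<^sub>1"
    unfolding K\<^sub>1_def using C(1) pos by (intro add_nonneg_pos add_nonneg_nonneg divide_nonneg_pos mult_nonneg_nonneg) auto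
  have K2: "0 < K\<^sub>2" unfolding K\<^sub>2_def using pos by (intro add_nonneg_pos) auto
  have "(\<integral>\<^sup>+ \<omega>. ennreal (inverse (rate CARD('d) n r) * sd_vol (adaptive C\<^sub>2 n T \<omega>) P) \<partial>sample_law n \<nu> P)
      \<le> ennreal (max K\<^sub>1 K\<^sub>2)"
    if \<nu>: "subgaussian_law \<sigma> \<nu>" and n: "2 \<le> n" and R: "CARD('d) + 1 \<le> R_max CARD('d) n"
      and T: "\<forall>r \<in> {CARD('d) + 1..R_max CARD('d) n}. is_estimator n r (T r)"
      and r: "enat (CARD('d) + 1) \<le> r" and P: "P \<in> shape_class r"
    for \<nu> n r and T :: "nat \<Rightarrow> 'd sample \<Rightarrow> (real ^ 'd) set" and P
  proof (cases "r \<le> enat (R_max CARD('d) n)")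
    case True
    then obtain m where m: "r = enat m" "m \<in> {CARD('d) + 1..R_max CARD('d) n}"
      using r by (cases r) auto
    define \<tau> where "\<tau> = ln (real n) / real n"
    have Pm: "P \<in> polytope_class m" using P unfolding m shape_class_def by simp
    have Pc: "P \<in> convex_class" using P shape_class_subset_convex_class by blast
    have \<tau>: "0 < \<tau>" "1 / real n \<le> 2 * \<tau>" using log_ratio_bounds[OF n] unfolding \<tau>_def by auto
    have m1: "1 \<le> real m" using m(2) by simp
    have rate: "rate CARD('d) n r = real m * \<tau>"
      unfolding m \<tau>_def using m(2) by (intro rate_le_R_max[OF n]) auto
    have "(\<integral>\<^sup>+ \<omega>. ennreal (inverse (rate CARD('d) n r) * sd_vol (adaptive C\<^sub>2 n T \<omega>) P) \<partial>sample_law n \<nu> P)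
      \<le> ennreal (inverse (rate CARD('d) n r) * (9 * ?D * real m * ln (real n) / (C\<^sub>2 * real n)
          + 2 * real (R_max CARD('d) n) * (C\<^sub>1 / (real n)\<^sup>2)))"
    proof (rule adaptive_risk_polytope[OF \<nu> Pc n R pos(3) T m(2)])
      fix s s' assume s: "s \<in> {CARD('d) + 1..R_max CARD('d) n}" "s' \<in> {m..R_max CARD('d) n}" "s \<le> s'" "m \<le> s"
      show "emeasure (sample_law n \<nu> P) {\<omega> \<in> space (sample_law n \<nu> P).
          3 * ?D * real s' * ln (real n) / (C\<^sub>2 * real n) \<le> sd_vol (T s \<omega>) P} \<le> ennreal (C\<^sub>1 / (real n)\<^sup>2)"
      proof (rule deviation_at_log_scale[OF \<nu> _ _ n d _ s(3) pos(2,3)])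
        show "is_estimator n s (T s)" using T s(1) by blast
        \<comment> \<open>The classes are nested, so the deviation inequality is available at every
          index above the true m.\<close>
        show "P \<in> polytope_class s" using Pm polytope_class_mono[OF s(4)] by blast
        show "1 \<le> s" using s(1) by simp
      qed (use deviation[OF \<nu> _ _ T[rule_format, OF s(1)]] n s(1) in auto)
    qed (use rate \<tau> pos in auto)
    also have "\<dots> \<le> ennreal K\<^sub>2"
    proof (rule ennreal_leI)
      have "2 * real (R_max CARD('d) n) * (C\<^sub>1 / (real n)\<^sup>2) \<le> 2 * (2 * real n) * (C\<^sub>1 / (real n)\<^sup>2)"
        using R_max_le[OF n] pos by (intro mult_right_mono mult_left_mono) auto
      also have "\<dots> = 4 * C\<^sub>1 * (1 / real n)" using n by (simp add: power2_eq_square)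
      also have "\<dots> \<le> 4 * C\<^sub>1 * (2 * \<tau>)" using \<tau> pos by (intro mult_left_mono) auto
      also have "\<dots> \<le> 8 * C\<^sub>1 * (real m * \<tau>)"
        using mult_right_mono[OF m1, of \<tau>] \<tau> pos by simp
      finally have "2 * real (R_max CARD('d) n) * (C\<^sub>1 / (real n)\<^sup>2) \<le> 8 * C\<^sub>1 * (real m * \<tau>)" .
      moreover have "9 * ?D * real m * ln (real n) / (C\<^sub>2 * real n) = 9 * ?D / C\<^sub>2 * (real m * \<tau>)"
        unfolding \<tau>_def by simp
      ultimately have "9 * ?D * real m * ln (real n) / (C\<^sub>2 * real n) + 2 * real (R_max CARD('d) n) * (C\<^sub>1 / (real n)\<^sup>2)
          \<le> K\<^sub>2 * (real m * \<tau>)"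
        unfolding K\<^sub>2_def by (simp only: distrib_right)
      then have "inverse (real m * \<tau>) * (9 * ?D * real m * ln (real n) / (C\<^sub>2 * real n)
          + 2 * real (R_max CARD('d) n) * (C\<^sub>1 / (real n)\<^sup>2)) \<le> inverse (real m * \<tau>) * (K\<^sub>2 * (real m * \<tau>))"
        using m1 \<tau> by (intro mult_left_mono) auto
      also have "\<dots> = K\<^sub>2" using m1 \<tau> by (auto simp: field_simps)
      finally show "inverse (rate CARD('d) n r) * (9 * ?D * real m * ln (real n) / (C\<^sub>2 * real n)
          + 2 * real (R_max CARD('d) n) * (C\<^sub>1 / (real n)\<^sup>2)) \<le> K\<^sub>2" unfolding rate .
    qed
    also have "\<dots> \<le> ennreal (max K\<^sub>1 K\<^sub>2)" by (intro ennreal_leI) simp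
    finally show ?thesis .
  next
    case False
    \<comment> \<open>This covers r = infinity and every finite r above the cutoff: in both
      situations the rate is the one for general convex sets.\<close>
    have rate: "rate CARD('d) n r = rate CARD('d) n \<infinity>"
      using False rate_gt_R_max[OF n] by (cases r) auto
    have Pc: "P \<in> convex_class" using P shape_class_subset_convex_class by blast
    have rate0: "0 < rate CARD('d) n \<infinity>" by (rule rate_infinity_pos[OF n])
    obtain Q where Q: "Q \<in> grid_polytope_class n (R_max CARD('d) n)" "sd_vol Q P \<le> C * rate CARD('d) n \<infinity>"
      using C(2)[OF n R Pc] by blast
    have "(\<integral>\<^sup>+ \<omega>. ennreal (inverse (rate CARD('d) n r) * sd_vol (adaptive C\<^sub>2 n T \<omega>) P) \<partial>sample_law n \<nu> P)
      \<le> ennreal (inverse (rate CARD('d) n r) * (K\<^sub>1 * rate CARD('d) n \<infinity>))"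
      unfolding K\<^sub>1_def k_def
      by (rule adaptive_risk_convex[OF \<nu> Pc n R pos(3) T pos(1) d Q]) (use rate rate0 in simp)
    also have "inverse (rate CARD('d) n r) * (K\<^sub>1 * rate CARD('d) n \<infinity>) = K\<^sub>1" using rate rate0 by simp
    also have "ennreal K\<^sub>1 \<le> ennreal (max K\<^sub>1 K\<^sub>2)" by (intro ennreal_leI) simp
    finally show ?thesis .
  qed
  then show ?thesis
    using K1 by (intro exI[of _ "max K\<^sub>1 K\<^sub>2"]) (auto intro!: SUP_least)
qed

end
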